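(* Let $d\geq 2$ be an integer and let $w\geq \bigl(3d+2+\sqrt{9d^2+4d+4}\bigr)/2$ be a real number. Let $a,b\in\mathbb{F}_q[T]$ be distinct non-constant polynomials. Define $(a_{n,w})_{n\geq1}$ by $a_{n,w}=b$ if $n=\lfloor w^i\rfloor$ for some integer $i\geq 0$, and $a_{n,w}=a$ otherwise. Let $\xi_w:=[0,a_{1,w},a_{2,w},\ldots]\in\mathbb{F}_q((T^{-1}))$. Then \[ w_n^{*}(\xi_w)=w-1,\qquad w_n(\xi_w)=w \] for all $2\leq n\leq d$.
   Context: Let $p$ be a prime and $q$ a power of $p$. $\mathbb{F}_q((T^{-1}))$ is the field of Laurent series $\xi=\sum_{n\geq N}a_nT^{-n}$ ($a_n\in\mathbb{F}_q$), with absolute value $|0|=0$ and $|\xi|=q^{-N}$ if $a_N\neq 0$; this absolute value is extended uniquely to an algebraic closure $\overline{\mathbb{F}_q(T)}$. For $a_0\in\mathbb{F}_q[T]$ and $a_1,a_2,\ldots\in\mathbb{F}_q[T]$ of degree $\geq1$, $[a_0,a_1,a_2,\ldots]$ denotes the (convergent) continued fraction $a_0+1/(a_1+1/(a_2+\cdots))$ in $\mathbb{F}_q((T^{-1}))$. The height $H(P)$ of $P\in(\mathbb{F}_q[T])[X]$ is the maximum of the absolute values of its coefficients. Every $\alpha\in\overline{\mathbb{F}_q(T)}$ is a root of a unique non-constant, irreducible, primitive $P\in(\mathbb{F}_q[T])[X]$ whose leading coefficient is monic in $T$; $H(\alpha)$ and $\deg\alpha$ denote the height and degree of this polynomial. For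 $\xi\in\mathbb{F}_q((T^{-1}))$ and $n\geq1$, $w_n(\xi)$ is the supremum of real $w$ such that $0<|P(\xi)|\leq H(P)^{-w}$ for infinitely many $P\in(\mathbb{F}_q[T])[X]$ of degree at most $n$, and $w_n^{*}(\xi)$ is the supremum of real $w^*$ such that $0<|\xi-\alpha|\leq H(\alpha)^{-w^*-1}$ for infinitely many $\alpha\in\overline{\mathbb{F}_q(T)}$ of degree at most $n$. *)

theory Defs
  imports
    Complex_Main
    "HOL-Library.Cardinality"
    "HOL-Library.Extended_Real"
    "HOL-Computational_Algebra.Computational_Algebra"
    "HOL-Algebra.Algebraic_Closure_Type"
begin

text \<open>
  The field of constants \<open>\<F>\<^sub>q\<close> is a type of class \<^class>\<open>finite_field\<close>, so \<open>q = CARD('a)\<close>.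
  The formal variable of \<^typ>\<open>'a fls\<close> plays the role of \<open>T\<^sup>-\<^sup>1\<close>, so that \<^typ>\<open>'a fls\<close> is
  \<open>\<F>\<^sub>q((T\<^sup>-\<^sup>1))\<close>, whereas the formal variable of \<^typ>\<open>'a poly\<close> is \<open>T\<close>.
\<close>

definition laurent_of_poly :: "'a::field poly \<Rightarrow> 'a fls" where
  "laurent_of_poly p = poly (map_poly fls_const p) fls_X_inv"

definition laurent_abs :: "'a::finite_field fls \<Rightarrow> real" where
  "laurent_abs f = (if f = 0 then 0 else real CARD('a) powi (- fls_subdegree f))"

text \<open>
  The field \<^typ>\<open>'a fls alg_closure\<close> contains \<open>\<F>\<^sub>q((T\<^sup>-\<^sup>1))\<close> via \<^const>\<open>to_ac\<close>.  Its elements that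
  are algebraic over \<open>\<F>\<^sub>q(T)\<close> form an algebraic closure of \<open>\<F>\<^sub>q(T)\<close>.  As \<open>\<F>\<^sub>q((T\<^sup>-\<^sup>1))\<close> is
  complete, exactly one function satisfies the following predicate.
\<close>

definition extends_laurent_abs :: "('a::finite_field fls alg_closure \<Rightarrow> real) \<Rightarrow> bool" where
  "extends_laurent_abs v \<longleftrightarrow>
     (\<forall>x. 0 \<le> v x) \<and> (\<forall>x. v x = 0 \<longleftrightarrow> x = 0) \<and>
     (\<forall>x y. v (x * y) = v x * v y) \<and> (\<forall>x y. v (x + y) \<le> v x + v y) \<and>
     (\<forall>f. v (to_ac f) = laurent_abs f)"

definition laurent_eval :: "'a::field poly poly \<Rightarrow> 'a fls \<Rightarrow> 'a fls" where
  "laurent_eval P \<xi> = poly (map_poly laurent_of_poly P) \<xi>"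

definition closure_eval :: "'a::field poly poly \<Rightarrow> 'a fls alg_closure \<Rightarrow> 'a fls alg_closure" where
  "closure_eval P \<alpha> = poly (map_poly (\<lambda>c. to_ac (laurent_of_poly c)) P) \<alpha>"

definition height :: "'a::finite_field poly poly \<Rightarrow> real" where
  "height P = Max ((\<lambda>i. laurent_abs (laurent_of_poly (coeff P i))) ` {..degree P})"

definition algebraic_elem :: "'a::field fls alg_closure \<Rightarrow> bool" where
  "algebraic_elem \<alpha> \<longleftrightarrow> (\<exists>P. P \<noteq> 0 \<and> closure_eval P \<alpha> = 0)"

definition primitive :: "'a::field poly poly \<Rightarrow> bool" where
  "primitive P \<longleftrightarrow> (\<forall>c. (\<forall>i. c dvd coeff P i) \<longrightarrow> is_unit c)"

definition min_poly :: "'a::field fls alg_closure \<Rightarrow> 'a poly poly" where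
  "min_poly \<alpha> = (THE P. degree P > 0 \<and> irreducible P \<and> primitive P \<and>
                        lead_coeff (lead_coeff P) = 1 \<and> closure_eval P \<alpha> = 0)"

definition elem_height :: "'a::finite_field fls alg_closure \<Rightarrow> real" where
  "elem_height \<alpha> = height (min_poly \<alpha>)"

definition elem_degree :: "'a::field fls alg_closure \<Rightarrow> nat" where
  "elem_degree \<alpha> = degree (min_poly \<alpha>)"

text \<open>
  The exponents \<open>w\<^sub>n\<close> and \<open>w\<^sub>n\<^sup>*\<close>, as suprema in the extended reals.
\<close>

definition w_exp :: "nat \<Rightarrow> 'a::finite_field fls \<Rightarrow> ereal" where
  "w_exp n \<xi> = Sup (ereal ` {w. infinite {P. degree P \<le> n \<and>
     0 < laurent_abs (laurent_eval P \<xi>) \<and>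
     laurent_abs (laurent_eval P \<xi>) \<le> height P powr (- w)}})"

definition w_star_exp ::
  "('a::finite_field fls alg_closure \<Rightarrow> real) \<Rightarrow> nat \<Rightarrow> 'a fls \<Rightarrow> ereal" where
  "w_star_exp v n \<xi> = Sup (ereal ` {w. infinite {\<alpha>. algebraic_elem \<alpha> \<and> elem_degree \<alpha> \<le> n \<and>
     0 < v (to_ac \<xi> - \<alpha>) \<and>
     v (to_ac \<xi> - \<alpha>) \<le> elem_height \<alpha> powr (- w - 1)}})"

fun cf_convergent :: "(nat \<Rightarrow> 'a::field poly) \<Rightarrow> nat \<Rightarrow> 'a fls" where
  "cf_convergent a 0 = laurent_of_poly (a 0)"
| "cf_convergent a (Suc n) = laurent_of_poly (a 0) + 1 / cf_convergent (\<lambda>k. a (Suc k)) n"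

text \<open>
  The library metric on \<^typ>\<open>'a fls\<close>, with distance \<open>2\<close> to the power \<open>- fls_subdegree (f - g)\<close>,
  induces the same topology as \<^const>\<open>laurent_abs\<close>.
\<close>

definition cf_value :: "(nat \<Rightarrow> 'a::field poly) \<Rightarrow> 'a fls" where
  "cf_value a = lim (cf_convergent a)"

definition cf_seq :: "'a::field poly \<Rightarrow> 'a poly \<Rightarrow> real \<Rightarrow> nat \<Rightarrow> 'a poly" where
  "cf_seq a b w n = (if n = 0 then 0 else if \<exists>i::nat. int n = \<lfloor>w ^ i\<rfloor> then b else a)"

end

theory Submission
  imports
    Defs
    "Berlekamp_Zassenhaus.Unique_Factorization_Poly"
    "Jordan_Normal_Form.Determinant"
begin

text \<open>
  Write \<open>n\<^sub>j = \<lfloor>w\<^sup>j\<rfloor>\<close>. Between the positions \<open>n\<^sub>j\<close> and \<open>n\<^bsub>j+1\<^esub>\<close> all partial quotients are \<open>a\<close>, so \<open>\<xi>\<close> is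
  extremely close to the quadratic number \<open>[0, a\<^sub>1, \<dots>, a\<^bsub>n\<^sub>j\<^esub>, a, a, a, \<dots>]\<close>. Its minimal polynomial
  \<open>G\<^sub>j\<close> has height \<open>H\<^sub>j\<close> comparable to \<open>\<bar>q\<^bsub>n\<^sub>j\<^esub>\<bar>\<^sup>2\<close>, and \<open>\<bar>G\<^sub>j(\<xi>)\<bar>\<close> is comparable to
  \<open>\<bar>q\<^bsub>n\<^bsub>j+1\<^esub>\<^esub>\<bar>\<^sup>-\<^sup>2\<close>, that is, to \<open>1 / H\<^bsub>j+1\<^esub>\<close>; since \<open>log H\<^bsub>j+1\<^esub> / log H\<^sub>j\<close> tends to \<open>w\<close> and the derivative of
  \<open>G\<^sub>j\<close> at \<open>\<xi>\<close> has the fixed absolute value \<open>\<bar>a\<bar>\<close>, this gives the lower bounds.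

  For the upper bounds, let \<open>P\<close> be irreducible of degree at most \<open>d\<close> and height \<open>H\<close>, and not proportional
  to any \<open>G\<^sub>j\<close>. The resultant of \<open>P\<close> and \<open>G\<^sub>j\<close> is a non-zero polynomial in \<open>T\<close>, hence has absolute value
  at least \<open>1\<close>, while expanding the Sylvester determinant bounds it by the larger one of
  \<open>\<bar>P(\<xi>)\<bar> H H\<^sub>j\<^sup>d\<close> and \<open>\<bar>G\<^sub>j(\<xi>)\<bar> H\<^sup>2 H\<^sub>j\<^bsup>d-1\<^esup>\<close>. The hypothesis on \<open>w\<close> makes the ranges of \<open>H\<close> in which
  this is useful for some \<open>j\<close> overlap, and yields \<open>\<bar>P(\<xi>)\<bar> \<ge> H\<^bsup>-(w-1)\<^esup>\<close> for all large \<open>H\<close>.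
\<close>

section \<open>The absolute value on Laurent series\<close>

lemma card_field_gt_1: "1 < real CARD('a::finite_field)"
proof -
  have "card {0, 1 :: 'a} \<le> CARD('a)" by (intro card_mono) auto
  thus ?thesis by simp
qed

lemma laurent_abs_0 [simp]: "laurent_abs 0 = 0"
  by (simp add: laurent_abs_def)

lemma laurent_abs_nonneg [simp]: "0 \<le> laurent_abs f"
  by (simp add: laurent_abs_def)

lemma laurent_abs_eq_0_iff [simp]: "laurent_abs f = 0 \<longleftrightarrow> f = 0"
  by (simp add: laurent_abs_def)

lemma laurent_abs_pos_iff [simp]: "0 < laurent_abs f \<longleftrightarrow> f \<noteq> 0"
  by (simp add: less_le)

lemma laurent_abs_1 [simp]: "laurent_abs 1 = 1"
  by (simp add: laurent_abs_def)

lemma laurent_abs_uminus [simp]: "laurent_abs (- f) = laurent_abs f"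
  by (simp add: laurent_abs_def)

lemma laurent_abs_minus_commute: "laurent_abs (f - g) = laurent_abs (g - f)"
  by (metis laurent_abs_uminus minus_diff_eq)

lemma laurent_abs_mult [simp]: "laurent_abs (f * g) = laurent_abs f * laurent_abs g"
  by (auto simp: laurent_abs_def power_int_add power_int_diff power_int_minus field_simps)

lemma laurent_abs_power [simp]: "laurent_abs (f ^ n) = laurent_abs f ^ n"
  by (induction n) auto

lemma laurent_abs_inverse [simp]: "laurent_abs (inverse f) = inverse (laurent_abs f)"
proof (cases "f = 0")
  case False
  then have "laurent_abs f * laurent_abs (inverse f) = 1"
    by (simp flip: laurent_abs_mult)
  thus ?thesis by (simp add: False inverse_unique)
qed auto

lemma laurent_abs_divide [simp]: "laurent_abs (f / g) = laurent_abs f / laurent_abs g"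
  by (simp add: divide_inverse)

lemma laurent_abs_prod: "laurent_abs (\<Prod>x\<in>A. f x) = (\<Prod>x\<in>A. laurent_abs (f x))"
  by (induction A rule: infinite_finite_induct) auto

lemma laurent_abs_le_iff:
  fixes f :: "'a::finite_field fls"
  assumes "f \<noteq> 0"
  shows "laurent_abs f \<le> real CARD('a) powi k \<longleftrightarrow> - k \<le> fls_subdegree f"
proof -
  have "real CARD('a) powi (- fls_subdegree f) \<le> real CARD('a) powi k" if "- fls_subdegree f \<le> k"
    using that card_field_gt_1[where 'a='a] by (intro power_int_increasing) auto
  moreover have "real CARD('a) powi k < real CARD('a) powi (- fls_subdegree f)" if "k < - fls_subdegree f"
    using that card_field_gt_1[where 'a='a] by (intro power_int_strict_increasing) auto
  ultimately have "laurent_abs f \<le> real CARD('a) powi k \<longleftrightarrow> - fls_subdegree f \<le> k"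
    using assms unfolding laurent_abs_def by (auto simp: not_le[symmetric])
  thus ?thesis by linarith
qed

lemma laurent_abs_add_le: "laurent_abs (f + g) \<le> max (laurent_abs f) (laurent_abs g)"
proof (cases "f = 0 \<or> g = 0 \<or> f + g = 0")
  case False
  then have "min (fls_subdegree f) (fls_subdegree g) \<le> fls_subdegree (f + g)"
    by (intro fls_plus_subdegree) auto
  hence "- fls_subdegree (f + g) \<le> - fls_subdegree f \<or> - fls_subdegree (f + g) \<le> - fls_subdegree g"
    by linarith
  thus ?thesis
    using False card_field_gt_1[where 'a='a] by (auto simp: laurent_abs_def le_max_iff_disj intro!: power_int_increasing)
qed (auto simp: le_max_iff_disj)

lemma laurent_abs_add_leI:
  "laurent_abs f \<le> B \<Longrightarrow> laurent_abs g \<le> B \<Longrightarrow> laurent_abs (f + g) \<le> B"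
  using laurent_abs_add_le[of f g] by linarith

lemma laurent_abs_diff_leI:
  "laurent_abs f \<le> B \<Longrightarrow> laurent_abs g \<le> B \<Longrightarrow> laurent_abs (f - g) \<le> B"
  using laurent_abs_add_leI[of f B "- g"] by simp

lemma laurent_abs_sum_le:
  assumes "\<And>x. x \<in> A \<Longrightarrow> laurent_abs (f x) \<le> B" "0 \<le> B"
  shows "laurent_abs (\<Sum>x\<in>A. f x) \<le> B"
  using assms by (induction A rule: infinite_finite_induct) (auto intro!: laurent_abs_add_leI)

text \<open>Isosceles principle: since \<open>f = (f + g) - g\<close>, a strict drop at
  \<open>f + g\<close> would contradict the ultrametric inequality.\<close>

lemma laurent_abs_add_eq:
  assumes "laurent_abs g < laurent_abs f"
  shows "laurent_abs (f + g) = laurent_abs f"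
  using laurent_abs_add_le[of "f + g" "- g"] laurent_abs_add_le[of f g] assms
  by auto

lemma laurent_abs_diff_eq:
  assumes "laurent_abs g < laurent_abs f"
  shows "laurent_abs (f - g) = laurent_abs f"
  using laurent_abs_add_eq[of "- g" f] assms by simp

section \<open>The embedding of \<open>F_q[T]\<close> into the Laurent series\<close>

lemma laurent_of_poly_pCons:
  "laurent_of_poly (pCons c p) = fls_const c + fls_X_inv * laurent_of_poly p"
proof -
  have "map_poly fls_const (pCons c p) = pCons (fls_const c) (map_poly fls_const p)"
    by (rule poly_eqI) (simp add: coeff_map_poly coeff_pCons split: nat.splits)
  thus ?thesis by (simp add: laurent_of_poly_def)
qed

text \<open>The series variable stands for the inverse of \<open>T\<close>, so exponents change
  sign. Additive facts about the embedding follow by comparing coefficients.\<close>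

lemma fls_nth_laurent_of_poly:
  fixes p :: "'a::field poly"
  shows "fls_nth (laurent_of_poly p) k = (if k \<le> 0 then coeff p (nat (- k)) else 0)"
proof (induction p arbitrary: k)
  case (pCons c p)
  note laurent_of_poly_pCons[of c p]
  moreover have "nat (- k) = Suc (nat (- k - 1))" if "k < 0"
    using that by linarith
  ultimately show ?case
    by (auto simp: pCons.IH fls_X_inv_times_conv_shift)
qed (auto simp: laurent_of_poly_def)

lemma laurent_of_poly_0 [simp]: "laurent_of_poly 0 = 0"
  and laurent_of_poly_1 [simp]: "laurent_of_poly 1 = 1"
  by (simp_all add: laurent_of_poly_def)

lemma laurent_of_poly_add [simp]: "laurent_of_poly (p + q) = laurent_of_poly p + laurent_of_poly q"
  by (simp add: fls_eq_iff fls_nth_laurent_of_poly)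

lemma laurent_of_poly_minus [simp]: "laurent_of_poly (- p) = - laurent_of_poly p"
  by (simp add: fls_eq_iff fls_nth_laurent_of_poly)

lemma laurent_of_poly_diff [simp]: "laurent_of_poly (p - q) = laurent_of_poly p - laurent_of_poly q"
  by (simp add: fls_eq_iff fls_nth_laurent_of_poly)

lemma laurent_of_poly_smult: "laurent_of_poly (smult c p) = fls_const c * laurent_of_poly p"
  by (simp add: fls_eq_iff fls_nth_laurent_of_poly)

lemma laurent_of_poly_mult [simp]: "laurent_of_poly (p * q) = laurent_of_poly p * laurent_of_poly q"
  by (induction p) (simp_all add: laurent_of_poly_pCons laurent_of_poly_smult algebra_simps)

lemma laurent_of_poly_eq_0_iff [simp]: "laurent_of_poly p = 0 \<longleftrightarrow> p = 0"
proof
  assume "laurent_of_poly p = 0"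
  then have "coeff p n = 0" for n
    using fls_nth_laurent_of_poly[of p "- int n"] by simp
  thus "p = 0" by (simp add: poly_eq_iff)
qed auto

interpretation laurent_of_poly: inj_idom_hom "laurent_of_poly :: 'a::field poly \<Rightarrow> 'a fls"
  by unfold_locales auto

interpretation to_ac_laurent_of_poly:
  inj_idom_hom "\<lambda>c. to_ac (laurent_of_poly c :: 'a::field fls)"
  by unfold_locales auto

lemma laurent_abs_of_poly:
  fixes p :: "'a::finite_field poly"
  assumes "p \<noteq> 0"
  shows "laurent_abs (laurent_of_poly p) = real CARD('a) ^ degree p"
proof -
  have "fls_subdegree (laurent_of_poly p) = - int (degree p)"
    using assms by (intro fls_subdegree_eqI) (auto simp: fls_nth_laurent_of_poly coeff_eq_0)
  thus ?thesis using assms by (simp add: laurent_abs_def)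
qed

lemma laurent_abs_of_poly_le:
  fixes p :: "'a::finite_field poly"
  assumes "degree p \<le> n"
  shows "laurent_abs (laurent_of_poly p) \<le> real CARD('a) ^ n"
  using assms card_field_gt_1[where 'a='a]
  by (cases "p = 0") (auto simp: laurent_abs_of_poly intro: power_increasing)

text \<open>The analogue of a nonzero integer having absolute value at least 1; it is applied to
  resultants.\<close>

lemma laurent_abs_of_poly_ge_1:
  fixes p :: "'a::finite_field poly"
  assumes "p \<noteq> 0"
  shows "1 \<le> laurent_abs (laurent_of_poly p)"
  using assms card_field_gt_1[where 'a='a] by (auto simp: laurent_abs_of_poly)

section \<open>Bivariate polynomials and their heights\<close>

text \<open>The base-\<open>q\<close> logarithm of \<open>height\<close>, as a natural number. It is
  0 for the zero polynomial, whose \<open>height\<close> is 0, so the two are linked only for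
  \<open>P \<noteq> 0\<close>.\<close>

definition log_height :: "'a::zero poly poly \<Rightarrow> nat" where
  "log_height P = Max ((\<lambda>i. degree (coeff P i)) ` {..degree P})"

lemma degree_coeff_le_log_height: "degree (coeff P i) \<le> log_height P"
proof (cases "i \<le> degree P")
  case True
  thus ?thesis unfolding log_height_def by (intro Max_ge) auto
qed (simp add: coeff_eq_0)

lemma log_height_leI: "(\<And>i. degree (coeff P i) \<le> h) \<Longrightarrow> log_height P \<le> h"
  by (auto simp: log_height_def)

lemma log_height_attained:
  assumes "P \<noteq> 0"
  obtains i where "coeff P i \<noteq> 0" "degree (coeff P i) = log_height P"
proof -
  have "log_height P \<in> (\<lambda>i. degree (coeff P i)) ` {..degree P}"
    unfolding log_height_def by (intro Max_in) auto
  then obtain i where i: "degree (coeff P i) = log_height P" by auto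
  show ?thesis
  proof (cases "coeff P i = 0")
    \<comment> \<open>Since \<open>degree 0 = 0\<close>, a zero coefficient realises the maximum
      only if the maximum is 0; the leading coefficient then realises it too.\<close>
    case True
    hence "degree (lead_coeff P) = log_height P"
      using i degree_coeff_le_log_height[of P "degree P"] by simp
    thus ?thesis using that[of "degree P"] assms by auto
  qed (use i that in auto)
qed

lemma height_eq_power:
  fixes P :: "'a::finite_field poly poly"
  assumes "P \<noteq> 0"
  shows "height P = real CARD('a) ^ log_height P"
proof -
  obtain i where i: "coeff P i \<noteq> 0" "degree (coeff P i) = log_height P"
    using log_height_attained[OF assms] .
  show ?thesis
    unfolding height_def
  proof (intro Max_eqI)
    show "real CARD('a) ^ log_height P
        \<in> (\<lambda>i. laurent_abs (laurent_of_poly (coeff P i))) ` {..degree P}"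
      using i by (intro image_eqI[of _ _ i]) (auto simp: laurent_abs_of_poly le_degree)
  qed (auto intro: laurent_abs_of_poly_le degree_coeff_le_log_height)
qed

text \<open>\<open>k\<close> and \<open>l\<close> are only bounds, so the coefficients there may
  vanish; this lets heights replace exact degrees in Gauss's lemma.\<close>

lemma coeff_mult_add_bounds:
  fixes p q :: "'a::comm_semiring_0 poly"
  assumes "degree p \<le> k" "degree q \<le> l"
  shows "coeff (p * q) (k + l) = coeff p k * coeff q l"
proof -
  have "coeff (p * q) (k + l) = (\<Sum>i\<le>k + l. coeff p i * coeff q (k + l - i))"
    by (simp add: coeff_mult)
  also have "\<dots> = (\<Sum>i\<in>{k}. coeff p i * coeff q (k + l - i))"
  proof (intro sum.mono_neutral_right ballI)
    fix i assume "i \<in> {..k + l} - {k}"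
    hence "degree p < i \<or> degree q < k + l - i" using assms by auto
    thus "coeff p i * coeff q (k + l - i) = 0" by (auto simp: coeff_eq_0)
  qed auto
  finally show ?thesis by simp
qed

text \<open>Gauss's lemma: the coefficients of the top power of \<open>T\<close> form a non-zero polynomial in \<open>X\<close>,
  and these polynomials multiply.\<close>

lemma log_height_mult:
  fixes A B :: "'a::field poly poly"
  assumes "A \<noteq> 0" "B \<noteq> 0"
  shows "log_height (A * B) = log_height A + log_height B"
proof (rule antisym)
  show "log_height (A * B) \<le> log_height A + log_height B"
  proof (rule log_height_leI)
    fix i
    show "degree (coeff (A * B) i) \<le> log_height A + log_height B"
      unfolding coeff_mult
      by (intro degree_sum_le order_trans[OF degree_mult_le] add_mono degree_coeff_le_log_height) auto
  qed
next
  define top where "top = (\<lambda>k (P :: 'a poly poly). map_poly (\<lambda>c. coeff c k) P)"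
  have coeff_top: "coeff (top k P) i = coeff (coeff P i) k" for k P i
    by (simp add: top_def coeff_map_poly)
  have top_nz: "top (log_height P) P \<noteq> 0" if nz: "P \<noteq> 0" for P :: "'a poly poly"
  proof -
    obtain i where "coeff P i \<noteq> 0" "degree (coeff P i) = log_height P"
      using log_height_attained[OF nz] .
    hence "coeff (top (log_height P) P) i \<noteq> 0" by (metis coeff_top leading_coeff_0_iff)
    thus ?thesis by auto
  qed
  have "top (log_height A + log_height B) (A * B) = top (log_height A) A * top (log_height B) B"
    by (rule poly_eqI)
      (simp add: coeff_top coeff_mult[of A B] coeff_mult[of "top _ _"] coeff_sum
         coeff_mult_add_bounds degree_coeff_le_log_height)
  hence "top (log_height A + log_height B) (A * B) \<noteq> 0"
    using top_nz[OF assms(1)] top_nz[OF assms(2)] by simp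
  then obtain i where "coeff (coeff (A * B) i) (log_height A + log_height B) \<noteq> 0"
    by (metis coeff_top leading_coeff_0_iff)
  thus "log_height A + log_height B \<le> log_height (A * B)"
    by (meson le_degree degree_coeff_le_log_height order_trans)
qed

section \<open>Finiteness and factorisation of bivariate polynomials\<close>

lemma finite_poly_bounded_degree:
  assumes "finite S"
  shows "finite {p :: 'a::zero poly. degree p \<le> n \<and> (\<forall>i. coeff p i \<in> S)}"
proof (rule finite_subset)
  show "{p. degree p \<le> n \<and> (\<forall>i. coeff p i \<in> S)} \<subseteq> Poly ` {xs. set xs \<subseteq> S \<and> length xs \<le> Suc n}"
  proof
    fix p :: "'a poly" assume p: "p \<in> {p. degree p \<le> n \<and> (\<forall>i. coeff p i \<in> S)}"
    hence "set (coeffs p) \<subseteq> S" "length (coeffs p) \<le> Suc n"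
      by (auto simp: coeffs_def)
    thus "p \<in> Poly ` {xs. set xs \<subseteq> S \<and> length xs \<le> Suc n}"
      by (metis (mono_tags, lifting) Poly_coeffs image_eqI mem_Collect_eq)
  qed
qed (use assms in \<open>simp add: finite_lists_length_le\<close>)

text \<open>Northcott property: finitely many constants give finitely many admissible coefficients.
  It converts height bounds into finiteness of the sets behind the exponents.\<close>

lemma finite_bounded_log_height:
  "finite {P :: 'a::finite_field poly poly. degree P \<le> n \<and> log_height P \<le> h}"
proof (rule finite_subset)
  show "finite {P :: 'a poly poly. degree P \<le> n \<and> (\<forall>i. coeff P i \<in> {c. degree c \<le> h})}"
    using finite_poly_bounded_degree[of "UNIV :: 'a set" h]
    by (intro finite_poly_bounded_degree) auto
qed (auto intro: order_trans[OF degree_coeff_le_log_height])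

lemma is_unit_bivariate_iff:
  fixes u :: "'a::field poly poly"
  shows "is_unit u \<longleftrightarrow> (\<exists>c. c \<noteq> 0 \<and> u = [:[:c:]:])"
proof
  assume "is_unit u"
  then obtain d where d: "u = [:d:]" "is_unit d" by (auto simp: is_unit_poly_iff)
  hence "d \<noteq> 0" "degree d = 0" by (auto simp: is_unit_iff_degree)
  then obtain c where "d = [:c:]" by (auto elim: degree_eq_zeroE)
  thus "\<exists>c. c \<noteq> 0 \<and> u = [:[:c:]:]" using d \<open>d \<noteq> 0\<close> by auto
qed (auto simp: is_unit_poly_iff)

lemma irreducible_dvd_irreducible:
  fixes P Q :: "'a::field poly poly"
  assumes "irreducible P" "irreducible Q" "P dvd Q"
  obtains c where "c \<noteq> 0" "Q = smult [:c:] P"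
proof -
  obtain u where u: "Q = P * u" using assms(3) by (elim dvdE)
  hence "is_unit u" using assms by (metis irreducibleD irreducible_not_unit)
  thus ?thesis using that u by (auto simp: is_unit_bivariate_iff)
qed

lemma log_height_smult_const:
  fixes P :: "'a::field poly poly"
  assumes "c \<noteq> 0"
  shows "log_height (smult [:c:] P) = log_height P"
  using assms by (simp add: log_height_def)

text \<open>\<open>degree\<close> and \<open>log_height\<close> both add under multiplication, and
  among nonzero polynomials their sum is 0 only for units, so proper factors are smaller.\<close>

lemma bivariate_factor_induct [consumes 1, case_names unit irreducible mult]:
  fixes P :: "'a::field poly poly"
  assumes "P \<noteq> 0"
    and unit: "\<And>u. is_unit u \<Longrightarrow> R u"
    and irred: "\<And>A. irreducible A \<Longrightarrow> R A"
    and mult: "\<And>A B. A \<noteq> 0 \<Longrightarrow> B \<noteq> 0 \<Longrightarrow> R A \<Longrightarrow> R B \<Longrightarrow> R (A * B)"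
  shows "R P"
  using assms(1)
proof (induction "degree P + log_height P" arbitrary: P rule: less_induct)
  case less
  have size: "0 < degree A + log_height A" if "A \<noteq> 0" "\<not> is_unit A" for A :: "'a poly poly"
  proof (rule ccontr)
    assume "\<not> 0 < degree A + log_height A"
    hence "degree A = 0" "degree (coeff A 0) = 0"
      using degree_coeff_le_log_height[of A 0] by auto
    then obtain c where "A = [:[:c:]:]" by (metis coeff_pCons_0 degree_0_id)
    thus False using that by (auto simp: is_unit_bivariate_iff)
  qed
  show ?case
  proof (cases "is_unit P \<or> irreducible P")
    case False
    then obtain A B where AB: "P = A * B" "\<not> is_unit A" "\<not> is_unit B"
      using less.prems by (auto simp: irreducible_def)
    with less.prems have nz: "A \<noteq> 0" "B \<noteq> 0" by auto
    have "degree P + log_height P = (degree A + log_height A) + (degree B + log_height B)"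
      using nz by (simp add: AB degree_mult_eq log_height_mult)
    thus ?thesis
      using less.hyps[of A] less.hyps[of B] mult[of A B] nz size[of A] size[of B] AB by simp
  qed (use unit irred in auto)
qed

section \<open>Evaluation in the Laurent series and in the algebraic closure\<close>

lemma laurent_eval_pCons [simp]:
  "laurent_eval (pCons c P) x = laurent_of_poly c + x * laurent_eval P x"
  by (simp add: laurent_eval_def hom_distribs)

lemma laurent_eval_0 [simp]: "laurent_eval 0 x = 0"
  by (simp add: laurent_eval_def)

lemma laurent_eval_smult [simp]:
  "laurent_eval (smult c P) x = laurent_of_poly c * laurent_eval P x"
  by (simp add: laurent_eval_def hom_distribs)

lemma laurent_eval_add [simp]: "laurent_eval (P + R) x = laurent_eval P x + laurent_eval R x"
  by (simp add: laurent_eval_def hom_distribs)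

lemma laurent_eval_mult [simp]: "laurent_eval (P * R) x = laurent_eval P x * laurent_eval R x"
  by (induction P) (simp_all add: algebra_simps)

lemma closure_eval_pCons [simp]:
  "closure_eval (pCons c P) x = to_ac (laurent_of_poly c) + x * closure_eval P x"
  by (simp add: closure_eval_def hom_distribs)

lemma closure_eval_0 [simp]: "closure_eval 0 x = 0"
  by (simp add: closure_eval_def)

lemma closure_eval_smult [simp]:
  "closure_eval (smult c P) x = to_ac (laurent_of_poly c) * closure_eval P x"
  by (simp add: closure_eval_def hom_distribs)

lemma closure_eval_add [simp]: "closure_eval (P + R) x = closure_eval P x + closure_eval R x"
  by (simp add: closure_eval_def hom_distribs)

lemma closure_eval_mult [simp]: "closure_eval (P * R) x = closure_eval P x * closure_eval R x"
  by (induction P) (simp_all add: algebra_simps)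

lemma closure_eval_to_ac: "closure_eval P (to_ac x) = to_ac (laurent_eval P x)"
  by (induction P) simp_all

section \<open>Resultants\<close>

text \<open>The determinant built from these rows is the resultant up to sign. Coefficients run in
  ascending order, which puts the constant terms in column 0, where evaluation takes place.\<close>

definition sylvester_row :: "'a::comm_semiring_1 poly \<Rightarrow> 'a poly \<Rightarrow> nat \<Rightarrow> 'a poly" where
  "sylvester_row P R i =
     (if i < degree R then monom 1 i * P else monom 1 (i - degree R) * R)"

definition sylvester :: "'a::comm_semiring_1 poly \<Rightarrow> 'a poly \<Rightarrow> 'a mat" where
  "sylvester P R = mat (degree P + degree R) (degree P + degree R)
     (\<lambda>(i, j). coeff (sylvester_row P R i) j)"

lemma sylvester_carrier [simp]:
  "sylvester P R \<in> carrier_mat (degree P + degree R) (degree P + degree R)"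
  by (simp add: sylvester_def)

lemma degree_sylvester_row_less:
  fixes P R :: "'a::idom poly"
  assumes "i < degree P + degree R"
  shows "degree (sylvester_row P R i) < degree P + degree R"
proof -
  have "degree (monom 1 k * p) \<le> k + degree p" for k and p :: "'a poly"
    by (meson degree_monom_le degree_mult_le add_le_mono1 order_trans)
  from this[of i P] this[of "i - degree R" R] show ?thesis
    using assms by (auto simp: sylvester_row_def)
qed

text \<open>A kernel vector of the transpose is a relation \<open>U P + V R = 0\<close> with
  \<open>U\<close>, \<open>V\<close> of degrees below those of \<open>R\<close>, \<open>P\<close>.
  The prime \<open>P\<close> divides \<open>V R\<close>, and it can divide \<open>V\<close> only if
  \<open>V = 0\<close>, which forces the vector to vanish.\<close>

lemma det_sylvester_0_imp_dvd:
  fixes P R :: "'a::ufd poly"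
  assumes "irreducible P" "0 < degree P" "det (sylvester P R) = 0"
  shows "P dvd R"
proof -
  let ?N = "degree P + degree R"
  have "det (transpose_mat (sylvester P R)) = 0"
    using assms(3) by (simp add: det_transpose[OF sylvester_carrier])
  then obtain v where v: "v \<in> carrier_vec ?N" "v \<noteq> 0\<^sub>v ?N"
    "transpose_mat (sylvester P R) *\<^sub>v v = 0\<^sub>v ?N"
    using det_0_iff_vec_prod_zero[of "transpose_mat (sylvester P R)" ?N] by auto
  define U where "U = (\<Sum>i<degree R. monom (v $ i) i)"
  define V where "V = (\<Sum>i<degree P. monom (v $ (degree R + i)) i)"
  have coeff_U: "coeff U i = (if i < degree R then v $ i else 0)" for i
    by (simp add: U_def coeff_sum)
  have coeff_V: "coeff V i = (if i < degree P then v $ (degree R + i) else 0)" for i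
    by (simp add: V_def coeff_sum)
  have sum_split: "(\<Sum>i<m + n. f i) = (\<Sum>i<m. f i) + (\<Sum>i<n. f (m + i))"
    for f :: "nat \<Rightarrow> 'a poly" and m n
    by (induction n) (simp_all add: add.assoc)
  have "(\<Sum>i<?N. smult (v $ i) (sylvester_row P R i)) = 0" (is "?S = 0")
  proof (rule poly_eqI)
    fix j
    show "coeff ?S j = coeff 0 j"
    proof (cases "j < ?N")
      case True
      have "0 = (transpose_mat (sylvester P R) *\<^sub>v v) $ j" using v(3) True by simp
      also have "\<dots> = (\<Sum>i<?N. coeff (sylvester_row P R i) j * v $ i)"
        using True v(1) by (auto simp: sylvester_def scalar_prod_def lessThan_atLeast0)
      finally show ?thesis by (simp add: coeff_sum mult.commute)
    next
      case False
      hence "coeff (sylvester_row P R i) j = 0" if "i < ?N" for i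
        using degree_sylvester_row_less[OF that] by (intro coeff_eq_0) linarith
      thus ?thesis by (simp add: coeff_sum)
    qed
  qed
  also have "?S = (\<Sum>i<degree R. smult (v $ i) (sylvester_row P R i)) +
      (\<Sum>i<degree P. smult (v $ (degree R + i)) (sylvester_row P R (degree R + i)))"
    by (subst add.commute) (rule sum_split)
  finally have UV: "U * P + V * R = 0"
    by (simp add: U_def V_def sylvester_row_def sum_distrib_right smult_monom
        flip: mult_smult_left)
  hence "P dvd V * R" by (metis add.inverse_unique dvd_minus_iff dvd_triv_right add.commute)
  moreover have "prime_elem P" using assms(1) by (simp add: prime_elem_iff_irreducible)
  ultimately consider "P dvd V" | "P dvd R" by (auto simp: prime_elem_dvd_mult_iff)
  thus ?thesis
  proof cases
    case 1
    have "degree V < degree P"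
      using assms(2) by (intro degree_lessI) (auto simp: coeff_V)
    hence "V = 0" using 1 by (metis divides_degree not_le)
    moreover have "U = 0" using UV \<open>V = 0\<close> assms(2) by auto
    ultimately have "v $ i = 0" if "i < ?N" for i
    proof (cases "i < degree R")
      case False
      hence "i - degree R < degree P" "degree R + (i - degree R) = i" using that by auto
      thus ?thesis using coeff_V[of "i - degree R"] \<open>V = 0\<close> by simp
    qed (use coeff_U[of i] \<open>U = 0\<close> in simp)
    hence "v = 0\<^sub>v ?N" using v(1) by auto
    thus ?thesis using v(2) by simp
  qed
qed

text \<open>Adding \<open>x\<^sup>j\<close> times column \<open>j\<close> to column \<open>0\<close>, for all \<open>j > 0\<close>, turns that column into the
  values at \<open>x\<close> of the multiples of the two polynomials.\<close>

lemma (in idom_hom) hom_det_sylvester: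
  assumes "0 < degree P + degree R"
  shows "hom (det (sylvester P R)) =
    det (mat (degree P + degree R) (degree P + degree R)
      (\<lambda>(i, j). if j = 0 then poly (map_poly hom (sylvester_row P R i)) x
               else hom (coeff (sylvester_row P R i) j)))" (is "_ = det ?A")
proof -
  let ?N = "degree P + degree R"
  \<comment> \<open>The column operation as a right factor: lower triangular with unit diagonal
    (\<open>x ^ 0 = 1\<close> in the corner), hence of determinant 1.\<close>
  define E where "E = mat ?N ?N (\<lambda>(i, j). if j = 0 then x ^ i else if i = j then 1 else 0)"
  have E: "E \<in> carrier_mat ?N ?N" by (simp add: E_def)
  have "det E = prod_list (diag_mat E)"
    by (rule det_lower_triangular[OF _ E]) (auto simp: E_def)
  also have "diag_mat E = replicate ?N 1"
    by (rule nth_equalityI) (auto simp: diag_mat_def E_def)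
  finally have "det E = 1" by simp
  have "map_mat hom (sylvester P R) * E = ?A"
  proof (rule eq_matI)
    fix i j assume "i < dim_row ?A" "j < dim_col ?A"
    hence ij: "i < ?N" "j < ?N" by auto
    have "(map_mat hom (sylvester P R) * E) $$ (i, j) =
        (\<Sum>k<?N. hom (coeff (sylvester_row P R i) k) * E $$ (k, j))"
      using ij E by (auto simp: sylvester_def scalar_prod_def lessThan_atLeast0)
    also have "\<dots> = ?A $$ (i, j)"
    proof (cases "j = 0")
      case True
      have "degree (map_poly hom (sylvester_row P R i)) < ?N"
        using degree_sylvester_row_less[OF ij(1)] degree_map_poly_le by (metis le_less_trans)
      hence "poly (map_poly hom (sylvester_row P R i)) x =
          (\<Sum>k<?N. coeff (map_poly hom (sylvester_row P R i)) k * x ^ k)"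
        by (subst poly_altdef, intro sum.mono_neutral_left) (auto intro!: le_degree)
      thus ?thesis using True ij by (auto simp: E_def)
    next
      case False
      hence "(\<Sum>k<?N. hom (coeff (sylvester_row P R i) k) * E $$ (k, j)) =
          (\<Sum>k<?N. if k = j then hom (coeff (sylvester_row P R i) k) else 0)"
        using ij by (intro sum.cong) (auto simp: E_def)
      thus ?thesis using ij False by simp
    qed
    finally show "(map_mat hom (sylvester P R) * E) $$ (i, j) = ?A $$ (i, j)" .
  qed (auto simp: sylvester_def E_def)
  hence "det ?A = det (map_mat hom (sylvester P R)) * det E"
    using det_mult[OF _ E, of "map_mat hom (sylvester P R)"] by simp
  thus ?thesis using \<open>det E = 1\<close> by simp
qed

lemma det_zero_first_column:
  fixes A :: "'a::comm_ring_1 mat"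
  assumes "A \<in> carrier_mat n n" "0 < n" "\<And>i. i < n \<Longrightarrow> A $$ (i, 0) = 0"
  shows "det A = 0"
proof -
  have "of_int (sign p) * (\<Prod>i = 0..<n. A $$ (i, p i)) = 0" if p: "p permutes {0..<n}" for p
  proof -
    obtain i where "i < n" "p i = 0"
      using permutes_surj[OF p] assms(2) permutes_in_image[OF p]
      by (metis atLeastLessThan_iff le0 surjD)
    hence "(\<Prod>i = 0..<n. A $$ (i, p i)) = 0"
      using assms(3)[of i] by (intro prod_zero) (auto intro!: bexI[of _ i])
    thus ?thesis by simp
  qed
  thus ?thesis using assms(1) by (auto simp: det_def)
qed

text \<open>A common root makes the evaluated column 0 vanish, hence the resultant. This yields
  uniqueness of minimal polynomials without passing to the fraction field.\<close>

lemma irreducible_common_root: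
  fixes P R :: "'a::field poly poly"
  assumes "irreducible P" "0 < degree P" "closure_eval P \<alpha> = 0" "closure_eval R \<alpha> = 0"
  shows "P dvd R"
proof (rule det_sylvester_0_imp_dvd)
  let ?h = "\<lambda>c :: 'a poly. to_ac (laurent_of_poly c)"
  have zero: "poly (map_poly ?h (sylvester_row P R i)) \<alpha> = 0" for i
    using closure_eval_mult[of _ P \<alpha>] closure_eval_mult[of _ R \<alpha>] assms(3,4)
    by (simp add: sylvester_row_def closure_eval_def)
  have "?h (det (sylvester P R)) = 0"
    using assms(2)
    by (subst to_ac_laurent_of_poly.hom_det_sylvester[of P R \<alpha>])
      (auto simp: zero intro!: det_zero_first_column[of _ "degree P + degree R"])
  thus "det (sylvester P R) = 0" by simp
qed (use assms in auto)

lemma laurent_abs_coeff_le_height: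
  fixes P :: "'a::finite_field poly poly"
  assumes "P \<noteq> 0"
  shows "laurent_abs (laurent_of_poly (coeff P i)) \<le> height P"
  using assms by (simp add: height_eq_power laurent_abs_of_poly_le degree_coeff_le_log_height)

lemma height_ge_1:
  fixes P :: "'a::finite_field poly poly"
  assumes "P \<noteq> 0"
  shows "1 \<le> height P"
  using assms card_field_gt_1[where 'a='a] by (simp add: height_eq_power)

text \<open>The resultant is a nonzero polynomial in \<open>T\<close>, so at least 1 in absolute
  value. In the Leibniz expansion with evaluated column 0, a term is at most the product of the row
  heights, times the ratio of value to height for the row that supplies column 0.\<close>

lemma sylvester_height_bound:
  fixes P R :: "'a::finite_field poly poly" and \<xi> :: "'a fls"
  assumes "irreducible P" "0 < degree P" "R \<noteq> 0" "\<not> P dvd R" "laurent_abs \<xi> \<le> 1"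
  shows "1 \<le> max (laurent_abs (laurent_eval P \<xi>) / height P) (laurent_abs (laurent_eval R \<xi>) / height R)
              * height P ^ degree R * height R ^ degree P"
proof -
  let ?N = "degree P + degree R"
  have P0: "P \<noteq> 0" using assms(2) by auto
  define A where "A = mat ?N ?N (\<lambda>(i, j). if j = 0 then laurent_eval (sylvester_row P R i) \<xi>
      else laurent_of_poly (coeff (sylvester_row P R i) j))"
  define B where "B = max (laurent_abs (laurent_eval P \<xi>) / height P) (laurent_abs (laurent_eval R \<xi>) / height R)"
  \<comment> \<open>\<open>c i\<close> bounds the entries of row \<open>i\<close> outside column 0;
    in column 0 the bound is \<open>B * c i\<close>.\<close>
  define c where "c = (\<lambda>i. if i < degree R then height P else height R)"
  have c_pos: "0 < c i" for i
    using height_ge_1[OF P0] height_ge_1[OF assms(3)] by (simp add: c_def)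
  have prod_c: "(\<Prod>i = 0..<?N. c i) = height P ^ degree R * height R ^ degree P"
  proof -
    have "(\<Prod>i = 0..<?N. c i) = (\<Prod>i = 0..<degree R. c i) * (\<Prod>i = degree R..<?N. c i)"
      by (subst prod.atLeastLessThan_concat) auto
    thus ?thesis by (simp add: c_def)
  qed
  have B0: "0 \<le> B"
    using height_ge_1[OF P0] by (auto simp: B_def le_max_iff_disj)
  have xi_pow: "laurent_abs \<xi> ^ k \<le> 1" for k
    using assms(5) by (intro power_le_one) auto
  have eval_monom: "laurent_eval (monom 1 k) \<xi> = \<xi> ^ k" for k
    by (induction k) (simp_all add: monom_0 monom_Suc laurent_eval_def[of 1])
  have col0: "laurent_abs (laurent_eval (sylvester_row P R i) \<xi>) \<le> B * c i" for i
  proof -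
    have A1: "laurent_abs (laurent_eval S \<xi>) \<le> B * height S" if "S = P \<or> S = R" for S
    proof -
      have "laurent_abs (laurent_eval S \<xi>) / height S \<le> B" using that by (auto simp: B_def)
      thus ?thesis using that height_ge_1[OF P0] height_ge_1[OF assms(3)]
        by (auto simp: divide_le_eq)
    qed
    have A2: "laurent_abs \<xi> ^ k * laurent_abs (laurent_eval S \<xi>) \<le> laurent_abs (laurent_eval S \<xi>)"
      for k S using mult_right_mono[OF xi_pow, of "laurent_abs (laurent_eval S \<xi>)" k] by simp
    have "laurent_abs \<xi> ^ k * laurent_abs (laurent_eval S \<xi>) \<le> B * height S"
      if "S = P \<or> S = R" for k S by (rule order_trans[OF A2 A1[OF that]])
    thus ?thesis by (auto simp: sylvester_row_def c_def eval_monom)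
  qed
  have cols: "laurent_abs (laurent_of_poly (coeff (sylvester_row P R i) j)) \<le> c i" for i j
    using height_ge_1[OF P0] height_ge_1[OF assms(3)] P0 assms(3)
    by (auto simp: sylvester_row_def c_def coeff_monom_mult laurent_abs_coeff_le_height)
  have "laurent_of_poly (det (sylvester P R)) = det A"
    unfolding A_def laurent_eval_def
    by (rule laurent_of_poly.hom_det_sylvester) (use assms(2) in auto)
  also have "laurent_abs \<dots> \<le> B * (height P ^ degree R * height R ^ degree P)"
  proof -
    have "laurent_abs (of_int (sign p) * (\<Prod>i = 0..<?N. A $$ (i, p i)))
        \<le> B * (height P ^ degree R * height R ^ degree P)" if p: "p permutes {0..<?N}" for p
    proof -
      \<comment> \<open>The row from which the permutation takes its entry of column 0.\<close>
      obtain k where k: "k < ?N" "p k = 0"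
        using permutes_surj[OF p] assms(2) permutes_in_image[OF p]
        by (metis atLeastLessThan_iff le0 surjD add_pos_nonneg)
      have pi: "p i < ?N" if "i < ?N" for i using permutes_in_image[OF p, of i] that by simp
      have "laurent_abs (of_int (sign p) :: 'a fls) = 1"
        by (cases "sign p = 1") (auto simp: sign_def)
      hence "laurent_abs (of_int (sign p) * (\<Prod>i = 0..<?N. A $$ (i, p i)))
          = (\<Prod>i = 0..<?N. laurent_abs (A $$ (i, p i)))"
        by (simp add: laurent_abs_prod)
      also have "\<dots> = laurent_abs (A $$ (k, p k)) * (\<Prod>i \<in> {0..<?N} - {k}. laurent_abs (A $$ (i, p i)))"
        using k by (intro prod.remove) auto
      also have "\<dots> \<le> (B * c k) * (\<Prod>i \<in> {0..<?N} - {k}. c i)"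
      proof (intro mult_mono prod_mono conjI)
        fix i assume i: "i \<in> {0..<?N} - {k}"
        hence "p i \<noteq> 0" using k permutes_inj[OF p] by (metis DiffE injD singletonI)
        thus "laurent_abs (A $$ (i, p i)) \<le> c i" using i pi[of i] cols by (auto simp: A_def)
      qed (use k col0[of k] B0 c_pos assms(2) in \<open>auto simp: A_def less_imp_le intro!: prod_nonneg\<close>)
      also have "\<dots> = B * (\<Prod>i = 0..<?N. c i)"
        using k by (subst prod.remove[of "{0..<?N}" k]) auto
      finally show ?thesis by (simp add: prod_c)
    qed
    moreover have "0 \<le> B * (height P ^ degree R * height R ^ degree P)"
      using B0 height_ge_1[OF P0] height_ge_1[OF assms(3)] by simp
    ultimately show ?thesis by (auto simp: det_def A_def[THEN arg_cong[of _ _ dim_row]]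
        A_def[THEN arg_cong[of _ _ dim_col]] intro!: laurent_abs_sum_le)
  qed
  finally have "laurent_abs (laurent_of_poly (det (sylvester P R)))
      \<le> B * (height P ^ degree R * height R ^ degree P)" .
  moreover have "det (sylvester P R) \<noteq> 0"
    using det_sylvester_0_imp_dvd[of P R] assms by blast
  ultimately show ?thesis
    unfolding B_def using laurent_abs_of_poly_ge_1[of "det (sylvester P R)"]
    by (simp add: mult.assoc)
qed

section \<open>Minimal polynomials\<close>

lemma irreducible_imp_primitive:
  fixes P :: "'a::field poly poly"
  assumes "irreducible P" "0 < degree P"
  shows "Defs.primitive P"
  unfolding Defs.primitive_def
proof (intro allI impI)
  fix c assume "\<forall>i. c dvd coeff P i"
  hence "[:c:] dvd P" by (simp add: const_poly_dvd_iff)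
  then obtain S where S: "P = [:c:] * S" by (elim dvdE)
  hence "is_unit [:c:] \<or> is_unit S" using assms(1) by (metis irreducibleD)
  moreover have "\<not> is_unit S"
  proof
    assume "is_unit S"
    hence "degree S = 0" by (auto simp: is_unit_bivariate_iff)
    thus False using S assms(2) by (simp split: if_splits)
  qed
  ultimately show "is_unit c" by (simp add: is_unit_const_poly_iff)
qed

text \<open>Normalising the leading coefficient meets every condition of the definite description,
  and \<open>irreducible_common_root\<close> gives uniqueness. Height and degree of
  \<open>\<alpha>\<close> can thus be read off any irreducible polynomial of positive degree
  vanishing there.\<close>

lemma min_poly_eq_smult:
  fixes P :: "'a::field poly poly"
  assumes "irreducible P" "0 < degree P" "closure_eval P \<alpha> = 0"
  obtains c where "c \<noteq> 0" "min_poly \<alpha> = smult [:c:] P"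
proof -
  define c where "c = inverse (lead_coeff (lead_coeff P))"
  define P' where "P' = smult [:c:] P"
  have c: "c \<noteq> 0" using assms(2) by (auto simp: c_def)
  have "irreducible ([:[:c:]:] * P)"
    by (subst irreducible_mult_unit_left) (use c assms in \<open>auto simp: is_unit_bivariate_iff\<close>)
  hence irr: "irreducible P'" by (simp add: P'_def)
  have deg: "0 < degree P'" using c assms(2) by (simp add: P'_def)
  have lead: "lead_coeff (lead_coeff P') = 1"
    using assms(2) c by (auto simp: P'_def c_def)
  have root: "closure_eval P' \<alpha> = 0" by (simp add: P'_def assms(3))
  have "min_poly \<alpha> = P'"
    unfolding min_poly_def
  proof (rule the_equality)
    fix R :: "'a poly poly"
    assume R: "0 < degree R \<and> irreducible R \<and> Defs.primitive R \<and>
      lead_coeff (lead_coeff R) = 1 \<and> closure_eval R \<alpha> = 0"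
    hence "P' dvd R" using irreducible_common_root[OF irr deg root] by blast
    then obtain e where e: "e \<noteq> 0" "R = smult [:e:] P'"
      using irreducible_dvd_irreducible[OF irr] R by blast
    hence "e = 1" using lead R by simp
    thus "R = P'" using e by (simp flip: one_pCons)
  qed (use irr deg lead root irreducible_imp_primitive in auto)
  thus ?thesis using that c by (simp add: P'_def)
qed

text \<open>Some irreducible factor of an annihilating polynomial vanishes at
  \<open>\<alpha>\<close>; it is not constant because a nonzero constant has no root.\<close>

lemma algebraic_elem_irreducible:
  fixes \<alpha> :: "'a::field fls alg_closure"
  assumes "algebraic_elem \<alpha>"
  obtains P where "irreducible P" "0 < degree P" "closure_eval P \<alpha> = 0"
proof -
  obtain P where P: "P \<noteq> 0" "closure_eval P \<alpha> = 0"
    using assms by (auto simp: algebraic_elem_def)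
  have "closure_eval P \<alpha> = 0 \<longrightarrow> (\<exists>R. irreducible R \<and> 0 < degree R \<and> closure_eval R \<alpha> = 0)"
    using P(1)
  proof (induction P rule: bivariate_factor_induct)
    case (unit u)
    thus ?case by (auto simp: is_unit_bivariate_iff)
  next
    case (irreducible A)
    have "0 < degree A" if "closure_eval A \<alpha> = 0"
    proof (rule ccontr)
      assume "\<not> 0 < degree A"
      then obtain c where c: "A = [:c:]" by (auto elim: degree_eq_zeroE)
      hence "c = 0" using that by simp
      thus False using irreducible c by simp
    qed
    thus ?case using irreducible by blast
  qed auto
  thus ?thesis using that P by blast
qed

lemma min_poly_properties:
  fixes \<alpha> :: "'a::field fls alg_closure"
  assumes "algebraic_elem \<alpha>"
  shows "irreducible (min_poly \<alpha>)" "0 < degree (min_poly \<alpha>)" "closure_eval (min_poly \<alpha>) \<alpha> = 0"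
proof -
  obtain P where P: "irreducible P" "0 < degree P" "closure_eval P \<alpha> = 0"
    using algebraic_elem_irreducible[OF assms] .
  obtain c where c: "c \<noteq> 0" "min_poly \<alpha> = smult [:c:] P" using min_poly_eq_smult[OF P] .
  have "irreducible ([:[:c:]:] * P)"
    by (subst irreducible_mult_unit_left) (use c P in \<open>auto simp: is_unit_bivariate_iff\<close>)
  thus "irreducible (min_poly \<alpha>)" by (simp add: c)
  show "0 < degree (min_poly \<alpha>)" "closure_eval (min_poly \<alpha>) \<alpha> = 0" using P c by simp_all
qed

lemma finite_algebraic_bounded:
  "finite {\<alpha> :: 'a::finite_field fls alg_closure. algebraic_elem \<alpha> \<and> elem_degree \<alpha> \<le> n \<and>
     log_height (min_poly \<alpha>) \<le> h}"
proof (rule finite_subset)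
  let ?S = "{P :: 'a poly poly. degree P \<le> n \<and> log_height P \<le> h} - {0}"
  let ?h = "\<lambda>c :: 'a poly. to_ac (laurent_of_poly c)"
  show "{\<alpha>. algebraic_elem \<alpha> \<and> elem_degree \<alpha> \<le> n \<and> log_height (min_poly \<alpha>) \<le> h}
    \<subseteq> (\<Union>P\<in>?S. {\<alpha>. poly (map_poly ?h P) \<alpha> = 0})"
  proof
    fix \<alpha> :: "'a fls alg_closure"
    assume "\<alpha> \<in> {\<alpha>. algebraic_elem \<alpha> \<and> elem_degree \<alpha> \<le> n \<and> log_height (min_poly \<alpha>) \<le> h}"
    thus "\<alpha> \<in> (\<Union>P\<in>?S. {\<alpha>. poly (map_poly ?h P) \<alpha> = 0})"
      using min_poly_properties[of \<alpha>]
      by (auto simp: elem_degree_def closure_eval_def intro!: bexI[of _ "min_poly \<alpha>"])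
  qed
  show "finite (\<Union>P\<in>?S. {\<alpha>. poly (map_poly ?h P) \<alpha> = 0})"
    using finite_bounded_log_height[where 'a='a, of n h]
    by (intro finite_UN_I finite_Diff poly_roots_finite) auto
qed

section \<open>Continued fractions of Laurent series\<close>

lemma laurent_abs_le_inverse_power_iff:
  fixes f :: "'a::finite_field fls"
  assumes "f \<noteq> 0"
  shows "laurent_abs f \<le> (1 / real CARD('a)) ^ n \<longleftrightarrow> int n \<le> fls_subdegree f"
  using laurent_abs_le_iff[OF assms, of "- int n"]
  by (simp add: power_int_minus power_int_of_nat power_divide inverse_eq_divide)

text \<open>The library metric has base 2 and \<open>laurent_abs\<close> has base \<open>q\<close>,
  but both only measure \<open>fls_subdegree\<close>.\<close>

lemma tendsto_fls_laurent_abs: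
  fixes f :: "nat \<Rightarrow> 'a::finite_field fls"
  assumes "\<And>n. laurent_abs (f n - l) \<le> (1 / real CARD('a)) ^ n"
  shows "f \<longlonglongrightarrow> l"
proof -
  have le: "dist (f n) l \<le> (1 / 2) ^ n" for n
  proof (cases "f n = l")
    case False
    hence "int n \<le> fls_subdegree (f n - l)"
      using assms[of n] laurent_abs_le_inverse_power_iff[of "f n - l" n] by simp
    moreover from this have "(2::real) ^ n \<le> 2 ^ nat (fls_subdegree (f n - l))"
      by (intro power_increasing) auto
    ultimately show ?thesis using False by (simp add: dist_fls_def power_divide field_simps)
  qed simp
  have "(\<lambda>n. (1 / 2 :: real) ^ n) \<longlonglongrightarrow> 0" by (intro LIMSEQ_power_zero) auto
  hence "(\<lambda>n. dist (f n) l) \<longlonglongrightarrow> 0"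
    by (rule tendsto_sandwich[OF _ _ tendsto_const, rotated 2]) (auto simp: le)
  thus ?thesis by (simp add: tendsto_dist_iff[of f])
qed

text \<open>Completeness: the step bound freezes coefficient \<open>k\<close> from index
  \<open>k\<close> on.\<close>

lemma laurent_abs_Cauchy_limit:
  fixes f :: "nat \<Rightarrow> 'a::finite_field fls"
  assumes "\<And>n. laurent_abs (f (Suc n) - f n) \<le> (1 / real CARD('a)) ^ Suc n"
  obtains l where "\<And>n. laurent_abs (l - f n) \<le> (1 / real CARD('a)) ^ Suc n"
proof -
  have step: "fls_nth (f (Suc n)) k = fls_nth (f n) k" if "k \<le> int n" for n k
  proof (cases "f (Suc n) = f n")
    case False
    hence "int (Suc n) \<le> fls_subdegree (f (Suc n) - f n)"
      using assms[of n] by (subst laurent_abs_le_inverse_power_iff[symmetric]) auto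
    hence "fls_nth (f (Suc n) - f n) k = 0"
      using that by (intro fls_eq0_below_subdegree) auto
    thus ?thesis by simp
  qed simp
  have stable: "fls_nth (f (n + m)) k = fls_nth (f n) k" if "k \<le> int n" for n m k
    using that by (induction m) (simp_all add: step)
  \<comment> \<open>Diagonal choice: coefficient \<open>k\<close> is read off where it is already
    stable; \<open>nat k = 0\<close> sends negative \<open>k\<close> to \<open>f 0\<close>.\<close>
  define l where "l = Abs_fls (\<lambda>k. fls_nth (f (nat k)) k)"
  have l: "fls_nth l k = fls_nth (f (nat k)) k" for k
    unfolding l_def
    by (rule nth_Abs_fls_lower_bound[of "min 0 (fls_subdegree (f 0))"])
      (auto simp: fls_eq0_below_subdegree)
  have agree: "fls_nth l k = fls_nth (f n) k" if "k \<le> int n" for k n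
    using stable[of k "nat k" "n - nat k"] that l by (cases "0 \<le> k") (auto simp: stable[of k 0 n, simplified])
  have "laurent_abs (l - f n) \<le> (1 / real CARD('a)) ^ Suc n" for n
  proof (cases "l = f n")
    case False
    hence "int (Suc n) \<le> fls_subdegree (l - f n)"
      by (intro fls_subdegree_geI) (auto simp: agree)
    thus ?thesis using False by (subst laurent_abs_le_inverse_power_iff) auto
  qed simp
  thus ?thesis using that by blast
qed

lemma laurent_abs_of_poly_gt_1:
  fixes p :: "'a::finite_field poly"
  assumes "0 < degree p"
  shows "1 < laurent_abs (laurent_of_poly p)" "real CARD('a) \<le> laurent_abs (laurent_of_poly p)"
proof -
  have "real CARD('a) ^ 1 \<le> real CARD('a) ^ degree p"
    using assms card_field_gt_1[where 'a='a] by (intro power_increasing) auto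
  moreover have "laurent_abs (laurent_of_poly p) = real CARD('a) ^ degree p"
    using assms by (intro laurent_abs_of_poly) auto
  ultimately show "real CARD('a) \<le> laurent_abs (laurent_of_poly p)" by simp
  thus "1 < laurent_abs (laurent_of_poly p)"
    using card_field_gt_1[where 'a='a] by (rule less_le_trans[rotated])
qed

text \<open>Here the leading quotient is nonconstant too, so it dominates the remainder, which has
  absolute value below 1.\<close>

lemma laurent_abs_cf_convergent:
  fixes t :: "nat \<Rightarrow> 'a::finite_field poly"
  assumes "\<And>k. 0 < degree (t k)"
  shows "laurent_abs (cf_convergent t n) = laurent_abs (laurent_of_poly (t 0))"
  using assms
proof (induction n arbitrary: t)
  case (Suc n)
  have "laurent_abs (cf_convergent (\<lambda>k. t (Suc k)) n) = laurent_abs (laurent_of_poly (t 1))"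
    using Suc.IH[of "\<lambda>k. t (Suc k)"] Suc.prems by simp
  hence "laurent_abs (1 / cf_convergent (\<lambda>k. t (Suc k)) n) < 1"
    using laurent_abs_of_poly_gt_1(1)[OF Suc.prems, of 1] by (simp add: divide_less_eq)
  also have "\<dots> < laurent_abs (laurent_of_poly (t 0))"
    by (intro laurent_abs_of_poly_gt_1 Suc.prems)
  finally have "laurent_abs (1 / cf_convergent (\<lambda>k. t (Suc k)) n) < laurent_abs (laurent_of_poly (t 0))" .
  thus ?case by (simp add: laurent_abs_add_eq)
qed simp

text \<open>Inversion contracts where both arguments have absolute value at least \<open>q\<close>,
  because the difference is divided by their product. One factor \<open>q\<close> is kept, the other
  is bounded below by 1.\<close>

lemma laurent_abs_diff_inverse_le:
  fixes x y :: "'a::finite_field fls"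
  assumes "real CARD('a) \<le> laurent_abs x" "real CARD('a) \<le> laurent_abs y"
    and "laurent_abs (x - y) \<le> (1 / real CARD('a)) ^ n"
  shows "laurent_abs (1 / x - 1 / y) \<le> (1 / real CARD('a)) ^ Suc n"
proof -
  have nz: "x \<noteq> 0" "y \<noteq> 0" using assms(1,2) card_field_gt_1[where 'a='a] by auto
  hence "1 / x - 1 / y = (y - x) / (x * y)" by (simp add: field_simps)
  hence "laurent_abs (1 / x - 1 / y) = laurent_abs (x - y) / (laurent_abs x * laurent_abs y)"
    by (simp add: laurent_abs_minus_commute)
  also have "\<dots> \<le> (1 / real CARD('a)) ^ n / (real CARD('a) * 1)"
    using assms card_field_gt_1[where 'a='a] by (intro frac_le mult_mono) auto
  finally show ?thesis by simp
qed

lemma cf_convergent_step: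
  fixes t :: "nat \<Rightarrow> 'a::finite_field poly"
  assumes "\<And>k. 0 < degree (t k)"
  shows "laurent_abs (cf_convergent t (Suc n) - cf_convergent t n) \<le> (1 / real CARD('a)) ^ Suc n"
  using assms
proof (induction n arbitrary: t)
  case 0
  have "1 / laurent_abs (laurent_of_poly (t (Suc 0))) \<le> 1 / real CARD('a)"
    using laurent_abs_of_poly_gt_1(2)[OF 0] by (intro frac_le) auto
  thus ?case by simp
next
  case (Suc n)
  let ?c = "cf_convergent (\<lambda>k. t (Suc k))"
  have "real CARD('a) \<le> laurent_abs (?c m)" for m
    using laurent_abs_of_poly_gt_1(2)[OF Suc.prems, of 1] Suc.prems
    by (simp add: laurent_abs_cf_convergent)
  moreover have "laurent_abs (?c (Suc n) - ?c n) \<le> (1 / real CARD('a)) ^ Suc n"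
    by (rule Suc.IH) (rule Suc.prems)
  ultimately have "laurent_abs (1 / ?c (Suc n) - 1 / ?c n) \<le> (1 / real CARD('a)) ^ Suc (Suc n)"
    by (intro laurent_abs_diff_inverse_le)
  thus ?case by simp
qed

lemma cf_value_approx:
  fixes t :: "nat \<Rightarrow> 'a::finite_field poly"
  assumes "\<And>k. 0 < degree (t k)"
  shows "laurent_abs (cf_value t - cf_convergent t n) \<le> (1 / real CARD('a)) ^ Suc n"
proof -
  obtain l where l: "\<And>n. laurent_abs (l - cf_convergent t n) \<le> (1 / real CARD('a)) ^ Suc n"
    using laurent_abs_Cauchy_limit[of "cf_convergent t"] cf_convergent_step[of t] assms by blast
  have "cf_convergent t \<longlonglongrightarrow> l"
  proof (rule tendsto_fls_laurent_abs)
    fix n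
    have "(1 / real CARD('a)) ^ Suc n \<le> (1 / real CARD('a)) ^ n"
      using card_field_gt_1[where 'a='a] by (intro power_decreasing) auto
    thus "laurent_abs (cf_convergent t n - l) \<le> (1 / real CARD('a)) ^ n"
      using l[of n] by (simp add: laurent_abs_minus_commute)
  qed
  hence "cf_value t = l" unfolding cf_value_def by (rule limI)
  thus ?thesis using l by simp
qed

lemma laurent_abs_cf_value:
  fixes t :: "nat \<Rightarrow> 'a::finite_field poly"
  assumes "\<And>k. 0 < degree (t k)"
  shows "laurent_abs (cf_value t) = laurent_abs (laurent_of_poly (t 0))"
proof -
  have "laurent_abs (cf_value t - laurent_of_poly (t 0)) \<le> 1 / real CARD('a)"
    using cf_value_approx[of t 0] assms by simp
  also have "\<dots> < 1" using card_field_gt_1[where 'a='a] by simp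
  also have "\<dots> < laurent_abs (laurent_of_poly (t 0))" by (intro laurent_abs_of_poly_gt_1 assms)
  finally show ?thesis
    using laurent_abs_add_eq[of "cf_value t - laurent_of_poly (t 0)" "laurent_of_poly (t 0)"] by simp
qed

text \<open>\<open>t 0\<close> is unrestricted, so the rule also starts an expansion with vanishing
  integer part. The limit passes through the inversion by its contraction property.\<close>

lemma cf_value_rec:
  fixes t :: "nat \<Rightarrow> 'a::finite_field poly"
  assumes "\<And>k. 0 < degree (t (Suc k))"
  shows "cf_value t = laurent_of_poly (t 0) + 1 / cf_value (\<lambda>k. t (Suc k))"
proof -
  let ?t = "\<lambda>k. t (Suc k)"
  have large: "real CARD('a) \<le> laurent_abs (cf_convergent ?t n)"
    "real CARD('a) \<le> laurent_abs (cf_value ?t)" for n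
    using laurent_abs_of_poly_gt_1(2)[OF assms, of 0] assms
    by (simp_all add: laurent_abs_cf_convergent laurent_abs_cf_value)
  have "(\<lambda>n. cf_convergent t (Suc n)) \<longlonglongrightarrow> laurent_of_poly (t 0) + 1 / cf_value ?t"
  proof (rule tendsto_fls_laurent_abs)
    fix n
    have "laurent_abs (cf_convergent ?t n - cf_value ?t) \<le> (1 / real CARD('a)) ^ Suc n"
      using cf_value_approx[of ?t n] assms by (simp add: laurent_abs_minus_commute)
    hence "laurent_abs (1 / cf_convergent ?t n - 1 / cf_value ?t) \<le> (1 / real CARD('a)) ^ Suc (Suc n)"
      by (intro laurent_abs_diff_inverse_le large)
    also have "\<dots> \<le> (1 / real CARD('a)) ^ n"
      using card_field_gt_1[where 'a='a] by (intro power_decreasing) auto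
    finally show "laurent_abs (cf_convergent t (Suc n) - (laurent_of_poly (t 0) + 1 / cf_value ?t))
        \<le> (1 / real CARD('a)) ^ n" by simp
  qed
  hence "cf_convergent t \<longlonglongrightarrow> laurent_of_poly (t 0) + 1 / cf_value ?t"
    by (rule LIMSEQ_imp_Suc)
  thus ?thesis unfolding cf_value_def by (rule limI)
qed

section \<open>Convergents, complete quotients and linear forms\<close>

text \<open>The indices are shifted by one against the usual ones: \<open>cf_den s n\<close> is \<open>q\<^bsub>n-1\<^esub>\<close> and
  \<open>cf_num s n\<close> is \<open>p\<^bsub>n-1\<^esub>\<close>, so that \<open>n = 0\<close> gives the conventional \<open>q\<^bsub>-1\<^esub> = 0\<close>, \<open>p\<^bsub>-1\<^esub> = 1\<close>.
  The integer part of the continued fraction is assumed to vanish.\<close>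

fun cf_den :: "(nat \<Rightarrow> 'a::field poly) \<Rightarrow> nat \<Rightarrow> 'a poly" where
  "cf_den s 0 = 0"
| "cf_den s (Suc 0) = 1"
| "cf_den s (Suc (Suc n)) = s (Suc n) * cf_den s (Suc n) + cf_den s n"

fun cf_num :: "(nat \<Rightarrow> 'a::field poly) \<Rightarrow> nat \<Rightarrow> 'a poly" where
  "cf_num s 0 = 1"
| "cf_num s (Suc 0) = 0"
| "cf_num s (Suc (Suc n)) = s (Suc n) * cf_num s (Suc n) + cf_num s n"

text \<open>The determinant alternates between -1 and 1; the square removes the dependence on
  parity.\<close>

lemma cf_det_square:
  "(cf_num s (Suc n) * cf_den s n - cf_num s n * cf_den s (Suc n)) ^ 2 = 1"
proof (induction n)
  case (Suc n)
  have "cf_num s (Suc (Suc n)) * cf_den s (Suc n) - cf_num s (Suc n) * cf_den s (Suc (Suc n)) =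
    - (cf_num s (Suc n) * cf_den s n - cf_num s n * cf_den s (Suc n))"
    by (simp add: algebra_simps)
  thus ?case using Suc.IH by (simp only: power2_minus)
qed simp

locale laurent_cf =
  fixes s :: "nat \<Rightarrow> 'a::finite_field poly"
  assumes s_0: "s 0 = 0" and degree_s: "0 < k \<Longrightarrow> 0 < degree (s k)"
begin

text \<open>Complete quotients; \<open>tail 0\<close> is the number itself.\<close>

definition tail :: "nat \<Rightarrow> 'a fls" where
  "tail k = cf_value (\<lambda>i. s (k + i))"

text \<open>This is the degree of the denominator of the convergent of index \<open>n\<close>,
  namely of \<open>cf_den s (Suc n)\<close>.\<close>

definition size :: "nat \<Rightarrow> nat" where
  "size n = (\<Sum>k=1..n. degree (s k))"

definition lin_form :: "nat \<Rightarrow> 'a fls" where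
  "lin_form n = laurent_of_poly (cf_den s n) * tail 0 - laurent_of_poly (cf_num s n)"

lemma tail_rec: "tail k = laurent_of_poly (s k) + 1 / tail (Suc k)"
  using cf_value_rec[of "\<lambda>i. s (k + i)"] by (simp add: tail_def degree_s)

lemma laurent_abs_tail: "0 < k \<Longrightarrow> laurent_abs (tail k) = real CARD('a) ^ degree (s k)"
  using laurent_abs_cf_value[of "\<lambda>i. s (k + i)"] laurent_abs_of_poly[of "s k"] degree_s[of k]
  by (cases "s k = 0") (simp_all add: tail_def degree_s)

lemma laurent_abs_tail_gt_1: "0 < k \<Longrightarrow> 1 < laurent_abs (tail k)"
  using degree_s[of k] card_field_gt_1[where 'a='a] by (simp add: laurent_abs_tail)

lemma tail_nonzero: "tail (Suc k) \<noteq> 0"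
  using laurent_abs_tail_gt_1[of "Suc k"] by auto

lemma size_0 [simp]: "size 0 = 0" and size_Suc: "size (Suc n) = size n + degree (s (Suc n))"
  by (simp_all add: size_def)

lemma tail_0: "tail 0 = 1 / tail 1"
  using tail_rec[of 0] by (simp add: s_0)

lemma laurent_abs_tail_0: "laurent_abs (tail 0) < 1"
  using laurent_abs_tail_gt_1[of 1] by (simp add: tail_0 divide_less_eq)

text \<open>The linear forms and the complete quotients obey recursions with the same quotient
  \<open>s (Suc n)\<close>, so the ratio of consecutive forms propagates by induction.\<close>

lemma lin_form_tail: "lin_form n = - tail (Suc n) * lin_form (Suc n)"
proof (induction n)
  case 0
  show ?case using tail_nonzero[of 0] by (simp add: lin_form_def tail_0)
next
  case (Suc n)
  have "lin_form (Suc (Suc n)) = laurent_of_poly (s (Suc n)) * lin_form (Suc n) + lin_form n"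
    by (simp add: lin_form_def algebra_simps)
  also have "\<dots> = (laurent_of_poly (s (Suc n)) - tail (Suc n)) * lin_form (Suc n)"
    by (subst Suc.IH) (simp add: algebra_simps)
  also have "\<dots> = - (lin_form (Suc n) / tail (Suc (Suc n)))"
    by (subst tail_rec) simp
  finally show ?case using tail_nonzero[of "Suc n"] by simp
qed

text \<open>By the index shift \<open>lin_form n\<close> belongs to the convergent of index
  \<open>n - 1\<close>, whose error is the inverse of the next denominator; hence
  \<open>size n\<close>.\<close>

lemma laurent_abs_lin_form: "laurent_abs (lin_form n) * real CARD('a) ^ size n = 1"
proof (induction n)
  case 0
  show ?case by (simp add: lin_form_def)
next
  case (Suc n)
  have "laurent_abs (lin_form n) = real CARD('a) ^ degree (s (Suc n)) * laurent_abs (lin_form (Suc n))"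
    by (subst lin_form_tail) (simp add: laurent_abs_tail)
  thus ?case using Suc.IH by (simp add: size_Suc power_add algebra_simps)
qed

text \<open>The alternative \<open>cf_den s n = 0\<close> covers \<open>n = 0\<close>, where degree
  and \<open>size\<close> are both 0 and the strict inequality fails.\<close>

lemma cf_den_degree: "cf_den s (Suc n) \<noteq> 0 \<and> degree (cf_den s (Suc n)) = size n
   \<and> (cf_den s n = 0 \<or> degree (cf_den s n) < size n)"
proof (induction n)
  case (Suc n)
  have "degree (s (Suc n) * cf_den s (Suc n)) = degree (s (Suc n)) + size n"
    using Suc.IH degree_s[of "Suc n"] by (subst degree_mult_eq) auto
  moreover have "degree (cf_den s n) < degree (s (Suc n)) + size n"
    using Suc.IH degree_s[of "Suc n"] by auto
  ultimately have "degree (cf_den s (Suc (Suc n))) = size (Suc n)"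
    by (simp add: degree_add_eq_left size_Suc)
  moreover have "0 < size (Suc n)" using degree_s[of "Suc n"] by (simp add: size_Suc)
  moreover have "degree (cf_den s (Suc n)) < size (Suc n)"
    using Suc.IH degree_s[of "Suc n"] by (simp add: size_Suc)
  ultimately show ?case by force
qed simp

lemma cf_den_degree_le: "degree (cf_den s n) \<le> size n"
  using cf_den_degree[of n] by auto

lemma cf_num_degree: "degree (cf_num s (Suc n)) \<le> size n \<and> degree (cf_num s n) \<le> size n"
proof (induction n)
  case (Suc n)
  have "degree (s (Suc n) * cf_num s (Suc n)) \<le> size (Suc n)"
    using Suc.IH degree_mult_le[of "s (Suc n)" "cf_num s (Suc n)"] by (simp add: size_Suc)
  moreover have "degree (cf_num s n) \<le> size (Suc n)" using Suc.IH by (simp add: size_Suc)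
  ultimately show ?case using Suc.IH by (auto simp: size_Suc degree_add_le)
qed simp

end

section \<open>Quadratic approximations\<close>

text \<open>A non-trivial solution would make \<open>Z/Y\<close> a root of \<open>X\<^sup>2 - a X - 1\<close>; the descent is Euclid's
  algorithm, which cannot terminate on \<open>[a, a, a, \<dots>]\<close>.\<close>

lemma quadratic_form_anisotropic:
  fixes a Y Z :: "'a::field poly"
  assumes "0 < degree a" "Y * Y + a * Y * Z = Z * Z"
  shows "Y = 0 \<and> Z = 0"
  using assms(2)
proof (induction "degree Y + degree Z" arbitrary: Y Z rule: less_induct)
  case less
  show ?case
  proof (cases "Y = 0 \<or> Z = 0")
    case True
    thus ?thesis using less.prems by auto
  next
    case False
    have "a \<noteq> 0" using assms(1) by auto
    hence aZ: "degree (a * Z) = degree a + degree Z"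
      using False by (simp add: degree_mult_eq)
    show ?thesis
    proof (cases "degree Z \<le> degree Y")
      case True
      \<comment> \<open>Euclidean step: \<open>(Z, W)\<close> solves the same equation with smaller
        total degree.\<close>
      define W where "W = Y + a * Z"
      have YW: "Y * W = Z * Z" using less.prems by (simp add: W_def algebra_simps)
      hence "W \<noteq> 0" using False by auto
      hence deg: "degree Y + degree W = degree Z + degree Z"
        using False arg_cong[OF YW, of degree] by (simp add: degree_mult_eq)
      have "degree W \<noteq> degree Y"
      proof
        assume "degree W = degree Y"
        hence "degree Y = degree Z" using deg by simp
        hence "degree W = degree a + degree Z"
          unfolding W_def using aZ assms(1) by (subst degree_add_eq_right) auto
        thus False using deg assms(1) \<open>degree Y = degree Z\<close> by simp
      qed
      hence "degree Z + degree W < degree Y + degree Z" using deg True by linarith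
      moreover have "Z * Z + a * Z * W = W * W"
        unfolding YW[symmetric] by (simp add: W_def algebra_simps)
      ultimately have "Z = 0" using less.hyps by blast
      thus ?thesis using False by simp
    next
      case lt: False
      \<comment> \<open>The step in the other direction, where \<open>(- Y, W)\<close> is the
        smaller solution.\<close>
      define W where "W = Z - a * Y"
      have ZW: "Z * W = Y * Y" unfolding W_def using less.prems by (simp add: algebra_simps)
      hence "W \<noteq> 0" using False by auto
      hence "degree Z + degree W = degree Y + degree Y"
        using False arg_cong[OF ZW, of degree] by (simp add: degree_mult_eq)
      hence "degree (- Y) + degree W < degree Y + degree Z" using lt by simp
      moreover have "(- Y) * (- Y) + a * (- Y) * W = W * W"
        using ZW by (simp add: W_def algebra_simps)
      ultimately have "- Y = 0" using less.hyps by blast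
      thus ?thesis using False by simp
    qed
  qed
qed

lemma laurent_of_poly_2: "laurent_of_poly 2 = 2"
  using laurent_of_poly_add[of 1 1] by simp

context laurent_cf
begin

text \<open>The polynomial with the root \<open>[0, s\<^sub>1, \<dots>, s\<^sub>m, a, a, a, \<dots>]\<close>: if \<open>p, q\<close> and \<open>p', q'\<close> come from
  the convergents of index \<open>m\<close> and \<open>m - 1\<close>, it is
  \<open>(q' X - p')\<^sup>2 + a (q' X - p') (q X - p) - (q X - p)\<^sup>2\<close>.\<close>

definition quad_approx :: "'a poly \<Rightarrow> nat \<Rightarrow> 'a poly poly" where
  "quad_approx a m =
     (let q = cf_den s (Suc m); q' = cf_den s m; p = cf_num s (Suc m); p' = cf_num s m in
      [: p' * p' + a * p * p' - p * p,
         p * q + p * q - a * (p * q' + p' * q) - (p' * q' + p' * q'),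
         q' * q' + a * q * q' - q * q :])"

text \<open>The coefficient is \<open>q' * q' - q * (q - a * q')\<close>. By the recursion
  \<open>q - a * q'\<close> contains \<open>(s m - a) * q'\<close>, so a mismatch at
  \<open>m\<close> makes the last product dominate. The degree is stated additively to avoid natural
  subtraction.\<close>

lemma quad_approx_leading_coeff:
  assumes "0 < m" "s m \<noteq> a"
  shows "coeff (quad_approx a m) 2 \<noteq> 0"
    and "degree (coeff (quad_approx a m) 2) + degree (s m) = 2 * size m + degree (s m - a)"
proof -
  obtain n where m: "m = Suc n" using assms(1) gr0_conv_Suc by auto
  define q where "q = cf_den s (Suc m)"
  define q' where "q' = cf_den s m"
  define q'' where "q'' = cf_den s n"
  define R where "R = (s m - a) * q' + q''"
  have q: "q = s m * q' + q''" by (simp add: q_def q'_def q''_def m)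
  have degs: "q \<noteq> 0" "degree q = size m" "q' \<noteq> 0" "degree q' = size n" "q'' = 0 \<or> degree q'' < size n"
    using cf_den_degree[of m] cf_den_degree[of n] by (auto simp: q_def q'_def q''_def m)
  have dR: "R \<noteq> 0 \<and> degree R = degree (s m - a) + size n"
  proof (cases "q'' = 0")
    case True
    thus ?thesis using degs assms(2) by (simp add: R_def degree_mult_eq)
  next
    case False
    have "degree ((s m - a) * q') = degree (s m - a) + size n"
      using degs assms(2) by (simp add: degree_mult_eq)
    moreover from this have "degree R = degree ((s m - a) * q')"
      unfolding R_def using False degs by (subst degree_add_eq_left) auto
    ultimately show ?thesis using False degs by auto
  qed
  have lc: "coeff (quad_approx a m) 2 = q' * q' - q * R"
    by (simp add: quad_approx_def Let_def numeral_2_eq_2 R_def q_def[symmetric] q'_def[symmetric])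
      (simp add: q algebra_simps)
  have "degree (q' * q') < degree (q * R)"
    using degs dR degree_s[of m] by (simp add: degree_mult_eq size_Suc m)
  hence "degree (q' * q' - q * R) = degree (q * R)"
    using degree_add_eq_right[of "q' * q'" "- (q * R)"] by simp
  moreover have "degree (q * R) + degree (s m) = 2 * size m + degree (s m - a)"
    using degs dR by (simp add: degree_mult_eq size_Suc m)
  ultimately show "degree (coeff (quad_approx a m) 2) + degree (s m) = 2 * size m + degree (s m - a)"
    by (simp add: lc)
  show "coeff (quad_approx a m) 2 \<noteq> 0"
    using \<open>degree (q' * q') < degree (q * R)\<close> by (auto simp: lc)
qed

lemma degree_quad_approx:
  assumes "0 < m" "s m \<noteq> a"
  shows "degree (quad_approx a m) = 2"
  using quad_approx_leading_coeff(1)[OF assms]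
  by (simp add: quad_approx_def Let_def numeral_2_eq_2)

lemma log_height_quad_approx_le: "log_height (quad_approx a m) \<le> 2 * size m + degree a"
proof (rule log_height_leI)
  fix i
  define q where "q = cf_den s (Suc m)"
  define q' where "q' = cf_den s m"
  define p where "p = cf_num s (Suc m)"
  define p' where "p' = cf_num s m"
  have q: "degree q \<le> size m" and q': "degree q' \<le> size m"
    and p: "degree p \<le> size m" and p': "degree p' \<le> size m"
    using cf_den_degree[of m] cf_den_degree_le[of m] cf_num_degree[of m]
    by (simp_all add: q_def q'_def p_def p'_def)
  have mult: "degree (x * y) \<le> 2 * size m + degree a" "degree (a * x * y) \<le> 2 * size m + degree a"
    "degree (a * (x * y)) \<le> 2 * size m + degree a"
    if "degree x \<le> size m" "degree y \<le> size m" for x y :: "'a poly"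
    using degree_mult_le[of x y] degree_mult_le[of a "x * y"] that by (simp_all add: mult.assoc)
  have "degree (p' * p' + a * p * p' - p * p) \<le> 2 * size m + degree a"
    by (intro degree_add_le degree_diff_le mult(1)[OF p' p'] mult(2)[OF p p'] mult(1)[OF p p])
  moreover have "degree (p * q + p * q - a * (p * q' + p' * q) - (p' * q' + p' * q')) \<le> 2 * size m + degree a"
    unfolding distrib_left[of a]
    by (intro degree_add_le degree_diff_le mult(1)[OF p q] mult(3)[OF p q'] mult(3)[OF p' q] mult(1)[OF p' q'])
  moreover have "degree (q' * q' + a * q * q' - q * q) \<le> 2 * size m + degree a"
    by (intro degree_add_le degree_diff_le mult(1)[OF q' q'] mult(2)[OF q q'] mult(1)[OF q q])
  ultimately show "degree (coeff (quad_approx a m) i) \<le> 2 * size m + degree a"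
    unfolding quad_approx_def Let_def q_def[symmetric] q'_def[symmetric] p_def[symmetric] p'_def[symmetric]
    by (simp only: coeff_pCons coeff_0 degree_0 split: nat.split) simp
qed

text \<open>A constant factor divides the homogenised value at \<open>(p, q)\<close>, which is the
  squared determinant of the convergents. Two linear factors would give a nontrivial zero of the
  anisotropic form.\<close>

lemma irreducible_quad_approx:
  assumes "0 < m" "s m \<noteq> a" "0 < degree a"
  shows "irreducible (quad_approx a m)"
proof (rule irreducibleI)
  note deg = degree_quad_approx[OF assms(1,2)]
  define q where "q = cf_den s (Suc m)"
  define q' where "q' = cf_den s m"
  define p where "p = cf_num s (Suc m)"
  define p' where "p' = cf_num s m"
  note defs = q_def[symmetric] q'_def[symmetric] p_def[symmetric] p'_def[symmetric]
  have det: "(p * q' - p' * q) ^ 2 = 1"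
    using cf_det_square[of s m] by (simp add: defs)
  let ?G = "quad_approx a m"
  have c0: "coeff ?G 0 = p' * p' + a * p * p' - p * p"
    and c1: "coeff ?G 1 = p * q + p * q - a * (p * q' + p' * q) - (p' * q' + p' * q')"
    and c2: "coeff ?G 2 = q' * q' + a * q * q' - q * q"
    by (simp_all add: quad_approx_def Let_def defs numeral_2_eq_2)
  show "?G \<noteq> 0" using deg by auto
  show "\<not> is_unit ?G" using deg by (auto simp: is_unit_bivariate_iff)
  fix A B assume AB: "?G = A * B"
  hence nz: "A \<noteq> 0" "B \<noteq> 0" using deg by auto
  hence deg_sum: "degree A + degree B = 2" using deg AB by (simp add: degree_mult_eq)
  have const_unit: "is_unit A" if A: "degree A = 0" "A dvd ?G" for A
  proof -
    obtain c where c: "A = [:c:]" using A by (auto elim: degree_eq_zeroE)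
    hence "c dvd coeff ?G i" for i using A by (simp add: const_poly_dvd_iff)
    \<comment> \<open>At \<open>p / q\<close> the form \<open>q X - p\<close> vanishes and only the
      square of \<open>q' X - p'\<close> survives.\<close>
    hence "c dvd coeff ?G 2 * (p * p) + coeff ?G 1 * (p * q) + coeff ?G 0 * (q * q)"
      by (intro dvd_add dvd_mult2)
    also have "\<dots> = (p * q' - p' * q) ^ 2"
      unfolding c0 c1 c2 by (simp add: power2_eq_square algebra_simps)
    finally have "is_unit c" using det by simp
    thus ?thesis using c by (simp add: is_unit_const_poly_iff)
  qed
  have "\<not> (degree A = 1 \<and> degree B = 1)"
  proof
    assume "degree A = 1 \<and> degree B = 1"
    then obtain u v u2 v2 where uv: "A = [:v, u:]" "B = [:v2, u2:]" "u \<noteq> 0"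
      by (metis degree1_coeffs)
    have e: "coeff ?G 0 = v * v2" "coeff ?G 1 = u * v2 + v * u2" "coeff ?G 2 = u * u2"
      unfolding AB uv by (simp_all add: numeral_2_eq_2 algebra_simps)
    \<comment> \<open>Up to the factor \<open>- u\<close>, \<open>Y\<close> and \<open>Z\<close> are
      \<open>q' X - p'\<close> and \<open>q X - p\<close> at the root \<open>- v / u\<close> of
      \<open>A\<close>.\<close>
    define Y where "Y = q' * v + p' * u"
    define Z where "Z = q * v + p * u"
    have "Y * Y + a * Y * Z - Z * Z = coeff ?G 2 * (v * v) - coeff ?G 1 * (u * v) + coeff ?G 0 * (u * u)"
      unfolding c0 c1 c2 Y_def Z_def by (simp add: algebra_simps)
    also have "\<dots> = 0" unfolding e by (simp add: algebra_simps)
    finally have "Y * Y + a * Y * Z = Z * Z" by simp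
    hence YZ: "Y = 0" "Z = 0" using quadratic_form_anisotropic[OF assms(3)] by auto
    have "(p * q' - p' * q) * u = q' * Z - q * Y"
      unfolding Y_def Z_def by (simp add: algebra_simps)
    hence "p * q' - p' * q = 0" using YZ uv(3) by simp
    thus False using det by simp
  qed
  hence "degree A = 0 \<or> degree B = 0" using deg_sum by linarith
  thus "is_unit A \<or> is_unit B" using const_unit AB by auto
qed

text \<open>The polynomial with root \<open>[a, a, a, ...]\<close>, evaluated at
  \<open>z\<close>.\<close>

definition quad_value :: "'a poly \<Rightarrow> 'a fls \<Rightarrow> 'a fls" where
  "quad_value a z = z * z - laurent_of_poly a * z - 1"

text \<open>Substituting \<open>lin_form m = - tail (Suc m) * lin_form (Suc m)\<close> lets the
  square factor out; what is left compares the tail with \<open>[a, a, a, ...]\<close>.\<close>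

lemma laurent_eval_quad_approx:
  "laurent_eval (quad_approx a m) (tail 0) = lin_form (Suc m) ^ 2 * quad_value a (tail (Suc m))"
proof -
  have "laurent_eval (quad_approx a m) (tail 0) =
      lin_form m * lin_form m + laurent_of_poly a * lin_form m * lin_form (Suc m)
      - lin_form (Suc m) * lin_form (Suc m)"
    by (simp add: quad_approx_def Let_def lin_form_def laurent_of_poly_2 algebra_simps)
  also have "\<dots> = lin_form (Suc m) ^ 2 * quad_value a (tail (Suc m))"
    by (simp add: lin_form_tail[of m] quad_value_def power2_eq_square algebra_simps)
  finally show ?thesis .
qed

text \<open>The number \<open>[a, a, a, ...]\<close> is unchanged when a quotient \<open>a\<close>
  is removed, so \<open>quad_value\<close> changes only by a sign and the square of the next
  complete quotient.\<close>

lemma laurent_abs_quad_value_step: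
  assumes "s k = a"
  shows "laurent_abs (quad_value a (tail k)) * real CARD('a) ^ (2 * degree (s (Suc k)))
    = laurent_abs (quad_value a (tail (Suc k)))"
proof -
  have "quad_value a (tail k) * tail (Suc k) ^ 2 = - quad_value a (tail (Suc k))"
    using assms tail_nonzero[of k]
    by (simp add: tail_rec[of k] quad_value_def field_simps power2_eq_square)
  hence "laurent_abs (quad_value a (tail k)) * laurent_abs (tail (Suc k)) ^ 2
      = laurent_abs (quad_value a (tail (Suc k)))"
    by (metis laurent_abs_mult laurent_abs_power laurent_abs_uminus)
  thus ?thesis by (simp add: laurent_abs_tail mult.commute flip: power_mult)
qed

text \<open>At a mismatch \<open>tail k - a\<close> is led by \<open>s k - a\<close>, so its product
  with \<open>tail k\<close> has absolute value above 1 and dominates the term 1.\<close>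

lemma laurent_abs_quad_value:
  assumes "0 < k" "s k \<noteq> a"
  shows "laurent_abs (quad_value a (tail k)) = real CARD('a) ^ (degree (s k) + degree (s k - a))"
proof -
  have small: "laurent_abs (1 / tail (Suc k)) < 1"
    using laurent_abs_tail_gt_1[of "Suc k"] by (simp add: divide_less_eq)
  have "tail k - laurent_of_poly a = laurent_of_poly (s k - a) + 1 / tail (Suc k)"
    by (subst tail_rec) simp
  also have "laurent_abs \<dots> = laurent_abs (laurent_of_poly (s k - a))"
    using small laurent_abs_of_poly_ge_1[of "s k - a"] assms by (intro laurent_abs_add_eq) simp
  also have "\<dots> = real CARD('a) ^ degree (s k - a)"
    using assms by (intro laurent_abs_of_poly) simp
  finally have diff: "laurent_abs (tail k - laurent_of_poly a) = real CARD('a) ^ degree (s k - a)" .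
  have "quad_value a (tail k) = tail k * (tail k - laurent_of_poly a) - 1"
    by (simp add: quad_value_def algebra_simps)
  moreover have prod: "laurent_abs (tail k * (tail k - laurent_of_poly a))
      = real CARD('a) ^ (degree (s k) + degree (s k - a))"
    using assms diff by (simp add: laurent_abs_tail power_add)
  moreover have "1 < real CARD('a) ^ (degree (s k) + degree (s k - a))"
    using degree_s[OF assms(1)] card_field_gt_1[where 'a='a] by simp
  ultimately show ?thesis by (metis laurent_abs_1 laurent_abs_diff_eq)
qed

text \<open>\<open>n\<close> is the first mismatch after \<open>m\<close>. The step lemma telescopes
  from \<open>Suc m\<close> to \<open>n\<close>, and the squared linear form cancels the remaining
  power. This leaves the inverse square of the denominator at \<open>n\<close>, up to a factor
  depending on \<open>s n\<close> and \<open>a\<close>.\<close>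

lemma laurent_abs_quad_approx:
  assumes "\<And>k. m < k \<Longrightarrow> k < n \<Longrightarrow> s k = a" "m < n" "s n \<noteq> a"
  shows "laurent_abs (laurent_eval (quad_approx a m) (tail 0)) * real CARD('a) ^ (2 * size n)
    = real CARD('a) ^ (degree (s n) + degree (s n - a))"
proof -
  have iter: "laurent_abs (quad_value a (tail (Suc m))) * real CARD('a) ^ (2 * size (Suc m + i))
      = laurent_abs (quad_value a (tail (Suc m + i))) * real CARD('a) ^ (2 * size (Suc m))"
    if "Suc m + i \<le> n" for i
    using that
  proof (induction i)
    case (Suc i)
    let ?k = "Suc m + i"
    have "laurent_abs (quad_value a (tail (Suc m))) * real CARD('a) ^ (2 * size (Suc m + Suc i))
      = laurent_abs (quad_value a (tail (Suc m))) * real CARD('a) ^ (2 * size ?k)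
         * real CARD('a) ^ (2 * degree (s (Suc ?k)))"
    proof -
      have "2 * size (Suc m + Suc i) = 2 * size ?k + 2 * degree (s (Suc ?k))"
        using size_Suc[of ?k] by simp
      thus ?thesis by (simp only: power_add mult.assoc)
    qed
    also have "\<dots> = laurent_abs (quad_value a (tail ?k)) * real CARD('a) ^ (2 * degree (s (Suc ?k)))
         * real CARD('a) ^ (2 * size (Suc m))"
      using Suc by (simp add: mult.commute mult.left_commute)
    also have "\<dots> = laurent_abs (quad_value a (tail (Suc ?k))) * real CARD('a) ^ (2 * size (Suc m))"
      using Suc.prems by (subst laurent_abs_quad_value_step) (auto intro: assms(1))
    finally show ?case by simp
  qed simp
  have n: "Suc m + (n - Suc m) = n" using assms(2) by simp
  have "laurent_abs (laurent_eval (quad_approx a m) (tail 0)) * real CARD('a) ^ (2 * size n)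
    = laurent_abs (lin_form (Suc m)) ^ 2 * (laurent_abs (quad_value a (tail (Suc m))) * real CARD('a) ^ (2 * size n))"
    by (simp add: laurent_eval_quad_approx)
  also have "\<dots> = (laurent_abs (lin_form (Suc m)) * real CARD('a) ^ size (Suc m)) ^ 2
      * laurent_abs (quad_value a (tail n))"
    using iter[of "n - Suc m"] assms(2) unfolding n
    by (simp add: power_mult_distrib power_mult mult.commute[of 2] mult.assoc)
  also have "\<dots> = real CARD('a) ^ (degree (s n) + degree (s n - a))"
    using assms by (simp only: laurent_abs_lin_form) (simp add: laurent_abs_quad_value)
  finally show ?thesis .
qed

text \<open>Only the term \<open>A * q * L'\<close> of the product rule has absolute value above 1,
  because \<open>q\<close> and \<open>L'\<close> are reciprocal in size. A derivative of fixed size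
  makes the value at \<open>tail 0\<close> comparable to the distance from the near root.\<close>

lemma laurent_abs_pderiv_quad_approx:
  assumes "s (Suc m) = a"
  shows "laurent_abs (laurent_eval (pderiv (quad_approx a m)) (tail 0)) = real CARD('a) ^ degree a"
proof -
  define q where "q = laurent_of_poly (cf_den s (Suc m))"
  define q' where "q' = laurent_of_poly (cf_den s m)"
  define L where "L = lin_form (Suc m)"
  define L' where "L' = lin_form m"
  define A where "A = laurent_of_poly a"
  let ?Q = "real CARD('a)"
  have a: "0 < degree a" "a \<noteq> 0" using degree_s[of "Suc m"] assms by auto
  have Q: "1 < ?Q" by (rule card_field_gt_1)
  have abs_q: "laurent_abs q = ?Q ^ size m" "laurent_abs q' \<le> ?Q ^ size m"
    using cf_den_degree[of m] cf_den_degree_le[of m]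
    by (auto simp: q_def q'_def laurent_abs_of_poly laurent_abs_of_poly_le)
  have abs_A: "laurent_abs A = ?Q ^ degree a" using a by (simp add: A_def laurent_abs_of_poly)
  have "laurent_abs L * ?Q ^ size (Suc m) = 1" unfolding L_def by (rule laurent_abs_lin_form)
  hence abs_AL: "laurent_abs A * laurent_abs L * ?Q ^ size m = 1"
    by (simp add: size_Suc assms power_add abs_A mult_ac)
  have abs_L': "laurent_abs L' * ?Q ^ size m = 1" unfolding L'_def by (rule laurent_abs_lin_form)
  have one_le_A: "1 \<le> laurent_abs A" using Q by (simp add: abs_A)
  have "laurent_abs L * ?Q ^ size m \<le> laurent_abs A * (laurent_abs L * ?Q ^ size m)"
    using mult_right_mono[OF one_le_A, of "laurent_abs L * ?Q ^ size m"] Q by simp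
  hence abs_L: "laurent_abs L * ?Q ^ size m \<le> 1" using abs_AL by (simp add: mult.assoc)
  have t1: "laurent_abs (q' * L') \<le> 1"
    using mult_right_mono[OF abs_q(2), of "laurent_abs L'"] abs_L' by (simp add: mult.commute)
  have t2: "laurent_abs (A * q' * L) \<le> 1"
    using mult_right_mono[OF abs_q(2), of "laurent_abs A * laurent_abs L"] abs_AL
    by (simp add: mult_ac)
  have t3: "laurent_abs (q * L) \<le> 1" using abs_L by (simp add: abs_q mult.commute)
  have t4: "laurent_abs (A * q * L') = ?Q ^ degree a"
    using abs_L' by (simp add: abs_q abs_A mult_ac)
  have "laurent_eval (pderiv (quad_approx a m)) (tail 0)
    = A * q * L' + (A * q' * L + ((q' * L' + q' * L') - (q * L + q * L)))"
    by (simp add: quad_approx_def Let_def pderiv_pCons lin_form_def q_def q'_def L_def L'_def A_def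
        laurent_of_poly_2 algebra_simps)
  moreover have "laurent_abs (A * q' * L + ((q' * L' + q' * L') - (q * L + q * L))) \<le> 1"
    by (intro laurent_abs_add_leI laurent_abs_diff_leI t1 t2 t3)
  moreover have "1 < ?Q ^ degree a" using Q a by simp
  ultimately show ?thesis using t4 by (metis laurent_abs_add_eq le_less_trans)
qed

end

section \<open>Growth of the heights\<close>

text \<open>\<open>K j\<close> models the logarithmic height of the \<open>j\<close>-th
  approximation. For the least \<open>j\<close> with the first inequality, its failure at
  \<open>j - 1\<close> bounds \<open>K j\<close> linearly in \<open>h\<close>, and
  \<open>slack\<close> makes the slope small enough for the second.\<close>

lemma gap_principle:
  fixes K :: "nat \<Rightarrow> real" and w C d :: real
  assumes ratio: "(\<lambda>j. K (Suc j) / K j) \<longlonglongrightarrow> w"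
    and top: "filterlim K at_top sequentially"
    and pos: "\<And>j. 0 < K j"
    and d: "1 \<le> d" "d < w" and slack: "2 * d * w < (w - 2) * (w - d + 1)"
  obtains h0 where "\<And>h. h0 \<le> h \<Longrightarrow>
    \<exists>j. 2 * h < K (Suc j) - (d - 1) * K j - C \<and> h + d * K j + C \<le> (w - 1) * h"
proof -
  have "((\<lambda>u. (w - 2) * (u - d + 1) - 2 * d * u) \<longlongrightarrow> (w - 2) * (w - d + 1) - 2 * d * w) (at_left w)"
    by (intro tendsto_intros)
  hence "eventually (\<lambda>u. 0 < (w - 2) * (u - d + 1) - 2 * d * u) (at_left w)"
    by (rule order_tendstoD(1)) (use slack in simp)
  moreover have "eventually (\<lambda>u. u \<in> {d<..<w}) (at_left w)"
    using d(2) by (rule eventually_at_left_real)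
  ultimately have "eventually (\<lambda>u. 0 < (w - 2) * (u - d + 1) - 2 * d * u \<and> u \<in> {d<..<w}) (at_left w)"
    by (rule eventually_conj)
  hence "\<exists>u. 0 < (w - 2) * (u - d + 1) - 2 * d * u \<and> u \<in> {d<..<w}"
    by (rule eventually_happens'[OF trivial_limit_at_left_real])
  then obtain u where u: "2 * d * u < (w - 2) * (u - d + 1)" "d < u" "u < w"
    by (auto simp: less_diff_eq)
  \<comment> \<open>For large \<open>j\<close>, \<open>K (Suc j) - (d - 1) * K j\<close> is at least
    \<open>A * K j\<close>; \<open>B\<close> is the slope in the resulting bound of
    \<open>d * K j\<close> by \<open>B * h\<close> plus a constant.\<close>
  define A where "A = u - d + 1"
  define B where "B = 2 * d * u / A"
  have A: "0 < A" using u by (simp add: A_def)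
  have B: "B < w - 2" using u A by (simp add: B_def A_def divide_less_eq)
  obtain N where N: "\<And>j. N \<le> j \<Longrightarrow> u * K j \<le> K (Suc j)"
  proof -
    have "eventually (\<lambda>j. u < K (Suc j) / K j) sequentially"
      using order_tendstoD(1)[OF ratio u(3)] .
    then obtain N where "\<And>j. N \<le> j \<Longrightarrow> u < K (Suc j) / K j"
      by (auto simp: eventually_sequentially)
    hence "u * K j \<le> K (Suc j)" if "N \<le> j" for j
      using that pos_less_divide_eq[OF pos[of j], of u "K (Suc j)"] by (simp add: less_imp_le)
    thus ?thesis by (rule that)
  qed
  define f where "f = (\<lambda>j. K (Suc j) - (d - 1) * K j - C)"
  have f_unbounded: "\<exists>j. x < f j" for x
  proof -
    have "eventually (\<lambda>j. (x + C) / A < K j) sequentially"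
      using top by (simp add: filterlim_at_top_dense)
    hence "eventually (\<lambda>j. (x + C) / A < K j \<and> N \<le> j) sequentially"
      using eventually_ge_at_top by (rule eventually_conj)
    then obtain j where j: "(x + C) / A < K j" "N \<le> j"
      using eventually_happens'[OF sequentially_bot] by blast
    have "x + C < A * K j" using j(1) A by (simp add: divide_less_eq mult.commute)
    also have "\<dots> \<le> f j + C" using N[OF j(2)] by (simp add: f_def A_def algebra_simps)
    finally show ?thesis by auto
  qed
  \<comment> \<open>The terms \<open>f j / 2\<close> force the least index beyond \<open>N\<close>;
    the quotient lets \<open>(w - 2 - B) * h\<close> absorb the additive constants.\<close>
  define h0 where "h0 = Max ({0, (d * C * u / A + C) / (w - 2 - B)} \<union> (\<lambda>j. f j / 2) ` {..N})"
  have "\<exists>j. 2 * h < K (Suc j) - (d - 1) * K j - C \<and> h + d * K j + C \<le> (w - 1) * h"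
    if h: "h0 \<le> h" for h
  proof -
    have bound: "x \<le> h" if "x \<in> {0, (d * C * u / A + C) / (w - 2 - B)} \<union> (\<lambda>j. f j / 2) ` {..N}" for x
      by (rule order_trans[OF Max_ge[OF _ that] h[unfolded h0_def]]) simp
    have h_ge: "0 \<le> h" "(d * C * u / A + C) / (w - 2 - B) \<le> h" "\<And>j. j \<le> N \<Longrightarrow> f j / 2 \<le> h"
      by (rule bound; simp)+
    define j where "j = (LEAST j. 2 * h < f j)"
    have j: "2 * h < f j" unfolding j_def using f_unbounded[of "2 * h"] by (rule LeastI_ex)
    have "N < j" using h_ge(3)[of j] j by (cases "N < j") auto
    then obtain i where i: "j = Suc i" "N \<le> i" using less_imp_Suc_add by (cases j) auto
    have "\<not> 2 * h < f i" using not_less_Least[of i "\<lambda>j. 2 * h < f j"] i by (simp add: j_def)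
    hence "K j \<le> 2 * h + C + (d - 1) * K i" by (simp add: f_def i)
    also have "(d - 1) * K i \<le> (d - 1) * (K j / u)"
      using N[OF i(2)] u d i by (intro mult_left_mono) (auto simp: le_divide_eq mult.commute)
    finally have "K j \<le> 2 * h + C + (d - 1) * (K j / u)" by simp
    hence "u * K j \<le> u * (2 * h + C + (d - 1) * (K j / u))"
      using u d by (intro mult_left_mono) auto
    also have "\<dots> = u * (2 * h + C) + (d - 1) * K j"
      using u d by (simp add: distrib_left)
    finally have "u * K j \<le> u * (2 * h + C) + (d - 1) * K j" .
    hence "A * K j \<le> u * (2 * h + C)" by (simp add: A_def algebra_simps)
    hence "K j \<le> u * (2 * h + C) / A" using A by (simp add: le_divide_eq mult.commute)
    hence "d * K j \<le> d * (u * (2 * h + C) / A)" using d by (intro mult_left_mono) auto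
    also have "\<dots> = B * h + d * C * u / A"
      by (simp add: B_def add_divide_distrib distrib_left mult_ac)
    finally have "h + d * K j + C \<le> h + B * h + (d * C * u / A + C)" by simp
    also have "d * C * u / A + C \<le> h * (w - 2 - B)"
      using h_ge(2) B by (simp add: divide_le_eq)
    finally have "h + d * K j + C \<le> (w - 1) * h" by (simp add: algebra_simps)
    thus ?thesis using j unfolding f_def by blast
  qed
  thus ?thesis using that by blast
qed

section \<open>The sparse continued fraction and the growth of its denominators\<close>

locale sparse_cf =
  fixes a b :: "'a::finite_field poly" and d :: nat and w :: real
  assumes d_ge_2: "2 \<le> d"
    and w_ge: "(3 * real d + 2 + sqrt (9 * real d ^ 2 + 4 * real d + 4)) / 2 \<le> w"
    and a_neq_b: "a \<noteq> b"
    and degree_a: "0 < degree a" and degree_b: "0 < degree b"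
begin

sublocale laurent_cf "cf_seq a b w"
  by unfold_locales (auto simp: cf_seq_def degree_a degree_b)

lemma w_gt: "3 * real d + 1 \<le> w"
proof -
  define r where "r = sqrt (9 * real d ^ 2 + 4 * real d + 4)"
  have "(3 * real d) ^ 2 \<le> 9 * real d ^ 2 + 4 * real d + 4" by (simp add: power2_eq_square)
  hence "3 * real d \<le> r" unfolding r_def by (rule real_le_rsqrt)
  moreover have "(3 * real d + 2 + r) / 2 \<le> w" using w_ge by (simp only: r_def)
  ultimately show ?thesis by argo
qed

lemma w_ge_7: "7 \<le> w"
  using w_gt d_ge_2 by linarith

text \<open>The bound in \<open>w_ge\<close> is the larger root of
  \<open>w\<^sup>2 - (3 d + 2) w + 2 d\<close>; the difference of the two sides exceeds this
  polynomial by \<open>w - 2\<close>.\<close>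

lemma w_slack: "2 * real d * w < (w - 2) * (w - real d + 1)"
proof -
  let ?r = "sqrt (9 * real d ^ 2 + 4 * real d + 4)"
  have "?r \<le> 2 * w - (3 * real d + 2)" using w_ge by simp
  hence "?r ^ 2 \<le> (2 * w - (3 * real d + 2)) ^ 2" by (intro power_mono) auto
  hence "9 * real d ^ 2 + 4 * real d + 4 \<le> (2 * w - (3 * real d + 2)) ^ 2" by simp
  thus ?thesis using w_ge_7 by (simp add: power2_eq_square algebra_simps)
qed

definition pos :: "nat \<Rightarrow> nat" where
  "pos j = nat \<lfloor>w ^ j\<rfloor>"

lemma pos_bounds: "real (pos j) \<le> w ^ j" "w ^ j - 1 < real (pos j)" "int (pos j) = \<lfloor>w ^ j\<rfloor>"
proof -
  have "0 \<le> \<lfloor>w ^ j\<rfloor>" using w_ge_7 by simp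
  thus "real (pos j) \<le> w ^ j" "w ^ j - 1 < real (pos j)" "int (pos j) = \<lfloor>w ^ j\<rfloor>"
    unfolding pos_def by linarith+
qed

lemma pos_0 [simp]: "pos 0 = 1"
  by (simp add: pos_def)

text \<open>A gap of 2 guarantees a quotient \<open>a\<close> immediately after each
  \<open>b\<close>, as the derivative estimate requires.\<close>

lemma pos_Suc_ge: "pos j + 2 \<le> pos (Suc j)"
proof -
  have "1 \<le> w ^ j" using w_ge_7 by simp
  moreover have "7 * w ^ j \<le> w ^ Suc j" using w_ge_7 by simp
  ultimately have "real (pos j) + 2 \<le> real (pos (Suc j))"
    using pos_bounds(1)[of j] pos_bounds(2)[of "Suc j"] by linarith
  thus ?thesis by linarith
qed

lemma strict_mono_pos: "strict_mono pos"
  unfolding strict_mono_Suc_iff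
proof
  show "pos j < pos (Suc j)" for j using pos_Suc_ge[of j] by simp
qed

lemma pos_gt_0: "0 < pos j"
  using strict_mono_less_eq[OF strict_mono_pos, of 0 j] by simp

lemma cf_seq_pos: "cf_seq a b w (pos j) = b"
  using pos_gt_0[of j] pos_bounds(3)[of j] by (auto simp: cf_seq_def)

lemma cf_seq_between:
  assumes "pos j < n" "n < pos (Suc j)"
  shows "cf_seq a b w n = a"
proof -
  have "int n \<noteq> \<lfloor>w ^ i\<rfloor>" for i
  proof
    assume "int n = \<lfloor>w ^ i\<rfloor>"
    hence "n = pos i" using pos_bounds(3)[of i] by simp
    thus False using assms strict_mono_less[OF strict_mono_pos] by auto
  qed
  thus ?thesis using assms by (auto simp: cf_seq_def)
qed

text \<open>Exactly \<open>j + 1\<close> of the first \<open>pos j\<close> quotients are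
  \<open>b\<close>, at \<open>pos 0\<close>, ..., \<open>pos j\<close>; the others are
  \<open>a\<close>.\<close>

lemma size_pos:
  "real (size (pos j)) = real (pos j) * real (degree a) + (real j + 1) * (real (degree b) - real (degree a))"
proof (induction j)
  case 0
  show ?case using cf_seq_pos[of 0] by (simp add: size_def)
next
  case (Suc j)
  have "pos j + i < pos (Suc j) \<Longrightarrow> size (pos j + i) = size (pos j) + i * degree a" for i
    by (induction i) (simp_all add: size_Suc cf_seq_between[of j])
  from this[of "pos (Suc j) - pos j - 1"]
  have "size (pos (Suc j) - 1) = size (pos j) + (pos (Suc j) - pos j - 1) * degree a"
    using pos_Suc_ge[of j] by simp
  moreover have "size (pos (Suc j)) = size (pos (Suc j) - 1) + degree b"
    using size_Suc[of "pos (Suc j) - 1"] pos_gt_0[of "Suc j"] cf_seq_pos[of "Suc j"] by simp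
  ultimately have "real (size (pos (Suc j))) =
      real (size (pos j)) + real (pos (Suc j) - pos j - 1) * real (degree a) + real (degree b)"
    by simp
  moreover have "real (pos (Suc j) - pos j - 1) = real (pos (Suc j)) - real (pos j) - 1"
    using pos_Suc_ge[of j] by simp
  ultimately show ?case unfolding Suc.IH by (simp add: algebra_simps)
qed

text \<open>The logarithm of the squared denominator at \<open>pos j\<close>; it agrees with
  \<open>log_height\<close> of the \<open>j\<close>-th quadratic approximation up to a bounded
  error.\<close>

definition K :: "nat \<Rightarrow> real" where
  "K j = 2 * real (size (pos j))"

text \<open>The correction for the quotients \<open>b\<close> is linear in \<open>j\<close> and
  vanishes against \<open>w ^ j\<close>; the floor costs at most 1.\<close>

lemma K_scaled_limit: "(\<lambda>j. K j / w ^ j) \<longlonglongrightarrow> 2 * real (degree a)"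
proof -
  have inv: "(\<lambda>j. (1 / w) ^ j) \<longlonglongrightarrow> 0"
    using w_ge_7 by (intro LIMSEQ_power_zero) auto
  have lin: "(\<lambda>j. real j * (1 / w) ^ j) \<longlonglongrightarrow> 0"
    using w_ge_7 by (intro powser_times_n_limit_0) auto
  have "(\<lambda>j. real (pos j) / w ^ j) \<longlonglongrightarrow> 1"
  proof (rule tendsto_sandwich)
    show "(\<lambda>j. 1 - (1 / w) ^ j) \<longlonglongrightarrow> 1" using tendsto_diff[OF tendsto_const[of 1] inv] by simp
    have "1 - (1 / w) ^ j \<le> real (pos j) / w ^ j" for j
      using pos_bounds(2)[of j] w_ge_7 by (simp add: field_simps power_divide)
    thus "\<forall>\<^sub>F j in sequentially. 1 - (1 / w) ^ j \<le> real (pos j) / w ^ j" by simp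
    have "real (pos j) / w ^ j \<le> 1" for j
      using pos_bounds(1)[of j] w_ge_7 by (simp add: divide_le_eq)
    thus "\<forall>\<^sub>F j in sequentially. real (pos j) / w ^ j \<le> 1" by simp
  qed simp
  hence "(\<lambda>j. 2 * (real (pos j) / w ^ j * real (degree a)
      + (real j * (1 / w) ^ j + (1 / w) ^ j) * (real (degree b) - real (degree a))))
    \<longlonglongrightarrow> 2 * (1 * real (degree a) + (0 + 0) * (real (degree b) - real (degree a)))"
    by (intro tendsto_intros inv lin)
  moreover have "K j / w ^ j = 2 * (real (pos j) / w ^ j * real (degree a)
      + (real j * (1 / w) ^ j + (1 / w) ^ j) * (real (degree b) - real (degree a)))" for j
    using w_ge_7 by (simp add: K_def size_pos field_simps power_divide)
  ultimately show ?thesis by simp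
qed

lemma K_pos: "0 < K j"
proof -
  have "degree (cf_seq a b w (pos j)) \<le> size (pos j)"
    unfolding size_def using pos_gt_0[of j] by (intro member_le_sum) auto
  thus ?thesis using degree_b by (simp add: K_def cf_seq_pos)
qed

lemma K_ratio: "(\<lambda>j. K (Suc j) / K j) \<longlonglongrightarrow> w"
proof -
  have "(\<lambda>j. (K (Suc j) / w ^ Suc j) / (K j / w ^ j) * w)
      \<longlonglongrightarrow> (2 * real (degree a)) / (2 * real (degree a)) * w"
    using LIMSEQ_Suc[OF K_scaled_limit] degree_a by (intro tendsto_intros K_scaled_limit) auto
  moreover have "(K (Suc j) / w ^ Suc j) / (K j / w ^ j) * w = K (Suc j) / K j" for j
    using w_ge_7 K_pos[of j] by (auto simp: field_simps)
  ultimately show ?thesis using degree_a by (simp only:) simp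
qed

lemma K_at_top: "filterlim K at_top sequentially"
proof -
  have "filterlim (\<lambda>j. w ^ j) at_top sequentially"
    using w_ge_7
    by (intro filterlim_at_infinity_imp_filterlim_at_top filterlim_realpow_sequentially_gt1) auto
  hence "filterlim (\<lambda>j. K j / w ^ j * w ^ j) at_top sequentially"
    using degree_a by (intro filterlim_tendsto_pos_mult_at_top[OF K_scaled_limit]) auto
  thus ?thesis using w_ge_7 by simp
qed

end

section \<open>The exponents\<close>

lemma infinite_if_unbounded:
  fixes f :: "'b \<Rightarrow> real"
  assumes "\<And>x. \<exists>y\<in>S. x < f y"
  shows "infinite S"
proof
  assume fin: "finite S"
  obtain y where "y \<in> S" "Max (f ` S) < f y" using assms by blast
  moreover have "f y \<le> Max (f ` S)" if "y \<in> S" for y using fin that by (intro Max_ge) auto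
  ultimately show False by force
qed

text \<open>For positive \<open>w\<close> it is enough to test nonnegative \<open>u\<close>; this
  permits multiplying height inequalities by \<open>u\<close>.\<close>

lemma Sup_ereal_eqI:
  assumes "0 < w" "\<And>u. u \<in> S \<Longrightarrow> u \<le> w" "\<And>u. 0 \<le> u \<Longrightarrow> u < w \<Longrightarrow> u \<in> S"
  shows "Sup (ereal ` S) = ereal w"
proof (rule antisym)
  show "Sup (ereal ` S) \<le> ereal w" by (rule SUP_least) (simp add: assms(2))
  show "ereal w \<le> Sup (ereal ` S)"
  proof (rule ccontr)
    assume "\<not> ereal w \<le> Sup (ereal ` S)"
    then obtain r where r: "Sup (ereal ` S) < ereal r" "ereal r < ereal w"
      using ereal_dense2 by (metis not_le)
    have "max r 0 \<in> S" using r assms(1) by (intro assms(3)) auto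
    hence "ereal (max r 0) \<le> Sup (ereal ` S)" by (intro SUP_upper)
    also note r(1)
    finally show False by simp
  qed
qed

lemma height_eq_powr:
  fixes P :: "'a::finite_field poly poly"
  assumes "P \<noteq> 0"
  shows "height P = real CARD('a) powr real (log_height P)"
  using assms card_field_gt_1[where 'a='a] by (simp add: height_eq_power powr_realpow)

lemma powr_le_imp_le_log:
  fixes q D e h :: real
  assumes "1 < q" "0 < e" "0 < D" "q powr (e * h) \<le> D"
  shows "h \<le> log q D / e"
proof -
  have "e * h = log q (q powr (e * h))" using assms by (subst log_powr_cancel) auto
  also have "\<dots> \<le> log q D" using assms by (subst log_le_cancel_iff) auto
  finally show ?thesis using assms by (simp add: le_divide_eq mult.commute)
qed

lemma laurent_abs_const: "c \<noteq> 0 \<Longrightarrow> laurent_abs (laurent_of_poly [:c:]) = 1"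
  by (subst laurent_abs_of_poly) auto

lemma laurent_abs_eval_le:
  assumes "laurent_abs \<xi> \<le> 1" "\<And>i. laurent_abs (laurent_of_poly (coeff P i)) \<le> H"
  shows "laurent_abs (laurent_eval P \<xi>) \<le> H"
  using assms(2)
proof (induction P)
  case 0
  show ?case using 0[of 0] by simp
next
  case (pCons c P)
  have "laurent_abs (laurent_eval P \<xi>) \<le> H"
    using pCons.prems[of "Suc _"] by (intro pCons.IH) simp
  moreover have "laurent_abs \<xi> * laurent_abs (laurent_eval P \<xi>) \<le> laurent_abs (laurent_eval P \<xi>)"
    using assms(1) by (intro mult_left_le_one_le) auto
  ultimately show ?case using pCons.prems[of 0] by (auto intro!: laurent_abs_add_leI)
qed

locale extended_abs =
  fixes v :: "'a::finite_field fls alg_closure \<Rightarrow> real"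
  assumes extends: "extends_laurent_abs v"
begin

lemma v_nonneg: "0 \<le> v x" and v_eq_0_iff: "v x = 0 \<longleftrightarrow> x = 0"
  and v_mult: "v (x * y) = v x * v y" and v_add_le: "v (x + y) \<le> v x + v y"
  and v_to_ac: "v (to_ac f) = laurent_abs f"
  using extends unfolding extends_laurent_abs_def by blast+

lemma v_minus: "v (- x) = v x"
proof -
  have "v (- x) = v (to_ac (- 1) * x)" by simp
  also have "\<dots> = v x" unfolding v_mult v_to_ac by simp
  finally show ?thesis .
qed

lemma v_diff_le: "v (x - y) \<le> v x + v y"
  using v_add_le[of x "- y"] by (simp add: v_minus)

text \<open>Horner induction with the plain triangle inequality that
  \<open>extends_laurent_abs\<close> supplies. The constant solves \<open>c' = 1 + 2 * c\<close>
  starting from 1; being independent of the height, it does not affect exponents.\<close>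

lemma v_eval_diff_le:
  assumes "laurent_abs \<xi> \<le> 1" "v \<alpha> \<le> 2"
    and "\<And>i. laurent_abs (laurent_of_poly (coeff P i)) \<le> H"
  shows "v (closure_eval P (to_ac \<xi>) - closure_eval P \<alpha>) \<le> (2 ^ Suc (degree P) - 1) * (v (to_ac \<xi> - \<alpha>) * H)"
  using assms(3)
proof (induction P)
  case 0
  show ?case using 0[of 0] v_eq_0_iff[of 0] v_nonneg by simp
next
  case (pCons c P)
  let ?x = "to_ac \<xi>" and ?D = "v (to_ac \<xi> - \<alpha>) * H"
  have coeffs: "laurent_abs (laurent_of_poly (coeff P i)) \<le> H" for i
    using pCons.prems[of "Suc i"] by simp
  have H: "0 \<le> ?D" using coeffs[of 0] v_nonneg laurent_abs_nonneg order_trans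
    by (metis mult_nonneg_nonneg)
  show ?case
  proof (cases "P = 0")
    case True
    thus ?thesis using H v_eq_0_iff[of 0] by simp
  next
    case False
    have "closure_eval (pCons c P) ?x - closure_eval (pCons c P) \<alpha> =
        (?x - \<alpha>) * closure_eval P ?x + \<alpha> * (closure_eval P ?x - closure_eval P \<alpha>)"
      by (simp add: algebra_simps)
    hence "v (closure_eval (pCons c P) ?x - closure_eval (pCons c P) \<alpha>) \<le>
        v (?x - \<alpha>) * v (closure_eval P ?x) + v \<alpha> * v (closure_eval P ?x - closure_eval P \<alpha>)"
      using v_add_le by (simp flip: v_mult)
    also have "\<dots> \<le> ?D + 2 * ((2 ^ Suc (degree P) - 1) * ?D)"
    proof (intro add_mono mult_mono)
      show "v (closure_eval P ?x) \<le> H"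
        unfolding closure_eval_to_ac v_to_ac by (intro laurent_abs_eval_le assms(1) coeffs)
    qed (use v_nonneg assms(2) pCons.IH[OF coeffs] in auto)
    also have "\<dots> = (2 ^ Suc (degree (pCons c P)) - 1) * ?D"
      using False by (simp add: algebra_simps)
    finally show ?thesis .
  qed
qed

text \<open>The expansion is about \<open>\<xi>\<close> instead of the root, since the derivative is
  known at \<open>\<xi>\<close>. It bounds the distance to the root from below.\<close>

lemma quadratic_taylor:
  fixes g0 g1 g2 :: "'a poly"
  assumes "closure_eval [:g0, g1, g2:] \<alpha> = 0"
  shows "laurent_abs (laurent_eval [:g0, g1, g2:] \<xi>) \<le> v (to_ac \<xi> - \<alpha>) *
    (laurent_abs (laurent_eval (pderiv [:g0, g1, g2:]) \<xi>) + laurent_abs (laurent_of_poly g2) * v (to_ac \<xi> - \<alpha>))"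
proof -
  let ?x = "to_ac \<xi>"
  have "to_ac (laurent_eval [:g0, g1, g2:] \<xi>) =
      closure_eval [:g0, g1, g2:] ?x - closure_eval [:g0, g1, g2:] \<alpha>"
    by (simp only: assms closure_eval_to_ac) simp
  also have "\<dots> = (?x - \<alpha>) * (to_ac (laurent_eval (pderiv [:g0, g1, g2:]) \<xi>)
      - to_ac (laurent_of_poly g2) * (?x - \<alpha>))"
    by (simp add: pderiv_pCons laurent_of_poly_2 algebra_simps)
  finally have "laurent_abs (laurent_eval [:g0, g1, g2:] \<xi>) =
      v (?x - \<alpha>) * v (to_ac (laurent_eval (pderiv [:g0, g1, g2:]) \<xi>)
      - to_ac (laurent_of_poly g2) * (?x - \<alpha>))"
    by (metis v_mult v_to_ac)
  also have "\<dots> \<le> v (?x - \<alpha>) * (laurent_abs (laurent_eval (pderiv [:g0, g1, g2:]) \<xi>)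
      + laurent_abs (laurent_of_poly g2) * v (?x - \<alpha>))"
    using v_diff_le v_nonneg by (intro mult_left_mono) (simp_all flip: v_mult v_to_ac)
  finally show ?thesis .
qed

text \<open>The derivative at \<open>\<xi>\<close> is the leading coefficient times the sum of the
  differences to the two roots. So the farther distance times that coefficient is at least 1/2, and
  the value at \<open>\<xi>\<close> controls the nearer one.\<close>

lemma quadratic_close_root:
  fixes g0 g1 g2 :: "'a poly"
  assumes "g2 \<noteq> 0" "1 \<le> laurent_abs (laurent_eval (pderiv [:g0, g1, g2:]) \<xi>)"
  obtains \<alpha> where "closure_eval [:g0, g1, g2:] \<alpha> = 0"
    "v (to_ac \<xi> - \<alpha>) \<le> 2 * laurent_abs (laurent_eval [:g0, g1, g2:] \<xi>)"
proof -
  let ?h = "\<lambda>c :: 'a poly. to_ac (laurent_of_poly c)" and ?x = "to_ac \<xi>"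
  have "\<exists>\<alpha>. poly [:?h g0, ?h g1, ?h g2:] \<alpha> = 0"
    using assms(1) by (intro alg_closed_imp_poly_has_root) simp
  then obtain \<alpha> where \<alpha>: "?h g0 + \<alpha> * (?h g1 + \<alpha> * ?h g2) = 0" by auto
  \<comment> \<open>The second root by Vieta's formula; a double root is included.\<close>
  define \<beta> where "\<beta> = - ?h g1 / ?h g2 - \<alpha>"
  have nz: "?h g2 \<noteq> 0" using assms(1) by simp
  have sum: "?h g1 = - ?h g2 * (\<alpha> + \<beta>)" using nz by (simp add: \<beta>_def)
  have prod: "?h g0 = ?h g2 * (\<alpha> * \<beta>)"
    using \<alpha> unfolding sum by (simp add: algebra_simps eq_neg_iff_add_eq_0)
  have factor: "closure_eval [:g0, g1, g2:] z = ?h g2 * ((z - \<alpha>) * (z - \<beta>))" for z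
    by (simp add: sum prod algebra_simps)
  have E: "laurent_abs (laurent_eval [:g0, g1, g2:] \<xi>) = v (?h g2) * (v (?x - \<alpha>) * v (?x - \<beta>))"
    using factor[of ?x] by (metis closure_eval_to_ac v_mult v_to_ac)
  have "to_ac (laurent_eval (pderiv [:g0, g1, g2:]) \<xi>) = ?h g2 * ((?x - \<alpha>) + (?x - \<beta>))"
    by (simp add: pderiv_pCons sum laurent_of_poly_2 algebra_simps)
  hence "laurent_abs (laurent_eval (pderiv [:g0, g1, g2:]) \<xi>) = v (?h g2) * v ((?x - \<alpha>) + (?x - \<beta>))"
    by (metis v_mult v_to_ac)
  also have "\<dots> \<le> v (?h g2) * (v (?x - \<alpha>) + v (?x - \<beta>))"
    by (intro mult_left_mono v_add_le v_nonneg)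
  finally have D: "1 \<le> v (?h g2) * (v (?x - \<alpha>) + v (?x - \<beta>))" using assms(2) by linarith
  have close: "x \<le> 2 * (c * (x * y))" if "0 \<le> x" "x \<le> y" "0 \<le> c" "1 \<le> c * (x + y)" for c x y :: real
  proof -
    have "c * x \<le> c * y" using that by (intro mult_left_mono) auto
    hence "1 \<le> 2 * (c * y)" using that(4) by (simp add: distrib_left)
    hence "x * 1 \<le> x * (2 * (c * y))" using that by (intro mult_left_mono) auto
    thus ?thesis by (simp add: mult_ac)
  qed
  show ?thesis
  proof (cases "v (?x - \<alpha>) \<le> v (?x - \<beta>)")
    case True
    have "v (?x - \<alpha>) \<le> 2 * (v (?h g2) * (v (?x - \<alpha>) * v (?x - \<beta>)))"
      using True v_nonneg D by (intro close) auto
    thus ?thesis using factor[of \<alpha>] E by (intro that[of \<alpha>]) simp_all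
  next
    case False
    have "v (?x - \<beta>) \<le> 2 * (v (?h g2) * (v (?x - \<beta>) * v (?x - \<alpha>)))"
      using False v_nonneg D by (intro close) (auto simp: add.commute)
    thus ?thesis using factor[of \<beta>] E by (intro that[of \<beta>]) (simp_all add: mult.commute)
  qed
qed

end

section \<open>Heights and values of the approximations \<open>G j\<close>, and the exponent for
  polynomials\<close>

context sparse_cf
begin

abbreviation \<xi> :: "'a fls" where "\<xi> \<equiv> tail 0"

abbreviation G :: "nat \<Rightarrow> 'a poly poly" where "G j \<equiv> quad_approx a (pos j)"

lemma xi_eq: "cf_value (cf_seq a b w) = \<xi>"
  by (simp add: tail_def)

lemma xi_le_1: "laurent_abs \<xi> \<le> 1"
  using laurent_abs_tail_0 by simp

lemma degree_G: "degree (G j) = 2"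
  using pos_gt_0 cf_seq_pos a_neq_b by (intro degree_quad_approx) auto

lemma G_nonzero: "G j \<noteq> 0"
  using degree_G[of j] by auto

lemma irreducible_G: "irreducible (G j)"
  using pos_gt_0 cf_seq_pos a_neq_b degree_a by (intro irreducible_quad_approx) auto

lemma log_height_G_le: "real (log_height (G j)) \<le> K j + real (degree a)"
  using log_height_quad_approx_le[of a "pos j"] by (simp add: K_def)

text \<open>The leading coefficient alone nearly attains the height; with
  \<open>log_height_G_le\<close> the height is pinned to \<open>K j\<close> up to constants.\<close>

lemma log_height_G_ge: "K j \<le> real (log_height (G j)) + real (degree b)"
proof -
  have "degree (coeff (G j) 2) + degree b = 2 * size (pos j) + degree (b - a)"
    using quad_approx_leading_coeff(2)[of "pos j" a] pos_gt_0[of j] a_neq_b by (simp add: cf_seq_pos)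
  moreover have "degree (coeff (G j) 2) \<le> log_height (G j)" by (rule degree_coeff_le_log_height)
  ultimately have "2 * size (pos j) \<le> log_height (G j) + degree b" by linarith
  thus ?thesis unfolding K_def by linarith
qed

lemma laurent_abs_G:
  "laurent_abs (laurent_eval (G j) \<xi>) =
     real CARD('a) powr (real (degree b) + real (degree (b - a)) - K (Suc j))"
proof -
  have "laurent_abs (laurent_eval (G j) \<xi>) * real CARD('a) ^ (2 * size (pos (Suc j)))
      = real CARD('a) ^ (degree b + degree (b - a))"
    using laurent_abs_quad_approx[of "pos j" "pos (Suc j)" a] cf_seq_between[of j]
      pos_Suc_ge[of j] a_neq_b by (simp add: cf_seq_pos)
  hence "laurent_abs (laurent_eval (G j) \<xi>) * real CARD('a) powr K (Suc j)
      = real CARD('a) powr (real (degree b) + real (degree (b - a)))"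
    using card_field_gt_1[where 'a='a] by (simp add: K_def flip: powr_realpow)
  thus ?thesis using card_field_gt_1[where 'a='a] by (simp add: powr_diff field_simps)
qed

lemma laurent_abs_pderiv_G:
  "laurent_abs (laurent_eval (pderiv (G j)) \<xi>) = real CARD('a) ^ degree a"
  using pos_Suc_ge[of j] by (intro laurent_abs_pderiv_quad_approx cf_seq_between[of j]) auto

text \<open>The resultant with \<open>G j\<close> leaves two alternatives. The index from
  \<open>gap_principle\<close> rules out that the value of \<open>G j\<close> dominates, so the
  value of \<open>P\<close> carries the bound.\<close>

lemma irreducible_lower_bound:
  obtains h0 where "\<And>P. irreducible P \<Longrightarrow> 0 < degree P \<Longrightarrow> degree P \<le> d \<Longrightarrow>
    h0 \<le> real (log_height P) \<Longrightarrow> (\<And>j. \<not> P dvd G j) \<Longrightarrow>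
    real CARD('a) powr (- ((w - 1) * real (log_height P))) \<le> laurent_abs (laurent_eval P \<xi>)"
proof -
  let ?Q = "real CARD('a)"
  have Q: "1 < ?Q" by (rule card_field_gt_1)
  \<comment> \<open>Collects the bounded errors: \<open>K j + degree a\<close> in place of the
    height of \<open>G j\<close>, and the constant in the exponent of
    \<open>laurent_abs_G\<close>.\<close>
  define C where "C = real d * real (degree a) + real (degree b) + real (degree (b - a))"
  obtain h0 where h0: "\<And>h. h0 \<le> h \<Longrightarrow>
    \<exists>j. 2 * h < K (Suc j) - (real d - 1) * K j - C \<and> h + real d * K j + C \<le> (w - 1) * h"
    using gap_principle[OF K_ratio K_at_top K_pos, of "real d" C] d_ge_2 w_gt w_slack by auto
  have "?Q powr (- ((w - 1) * real (log_height P))) \<le> laurent_abs (laurent_eval P \<xi>)"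
    if P: "irreducible P" "0 < degree P" "degree P \<le> d" "h0 \<le> real (log_height P)"
      "\<And>j. \<not> P dvd G j" for P
  proof -
    define h where "h = real (log_height P)"
    define n where "n = real (degree P)"
    obtain j where j: "2 * h < K (Suc j) - (real d - 1) * K j - C" "h + real d * K j + C \<le> (w - 1) * h"
      using h0[of h] P(4) by (auto simp: h_def)
    define g where "g = real (log_height (G j))"
    have n: "1 \<le> n" "n \<le> real d" using P(2,3) by (auto simp: n_def)
    have g: "0 \<le> g" "g \<le> K j + real (degree a)" using log_height_G_le[of j] by (simp_all add: g_def)
    have ng: "n * g \<le> real d * (K j + real (degree a))" and
      ng': "(n - 1) * g \<le> (real d - 1) * (K j + real (degree a))"
      using n g by (auto intro!: mult_mono)
    have heights: "height P = ?Q powr h" "height (G j) = ?Q powr g"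
      using P(2) G_nonzero by (auto simp: h_def g_def intro!: height_eq_powr)
    have powers: "height P ^ degree (G j) * height (G j) ^ degree P = ?Q powr (2 * h + n * g)"
      by (simp add: heights degree_G powr_add n_def powr_power mult.commute)
    have "1 \<le> max (laurent_abs (laurent_eval P \<xi>) / height P) (laurent_abs (laurent_eval (G j) \<xi>) / height (G j))
              * ?Q powr (2 * h + n * g)"
      using sylvester_height_bound[OF P(1,2) G_nonzero P(5) xi_le_1, of j]
      unfolding mult.assoc powers .
    then consider "1 \<le> laurent_abs (laurent_eval P \<xi>) / height P * ?Q powr (2 * h + n * g)"
      | "1 \<le> laurent_abs (laurent_eval (G j) \<xi>) / height (G j) * ?Q powr (2 * h + n * g)"
      by (auto simp: max_def split: if_splits)
    thus ?thesis
    proof cases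
      case 1
      also have "laurent_abs (laurent_eval P \<xi>) / height P * ?Q powr (2 * h + n * g) =
          laurent_abs (laurent_eval P \<xi>) * ?Q powr (2 * h + n * g - h)"
        unfolding heights powr_diff by simp
      also have "2 * h + n * g - h = h + n * g" by simp
      finally have "1 \<le> laurent_abs (laurent_eval P \<xi>) * ?Q powr (h + n * g)" .
      hence "?Q powr (- (h + n * g)) \<le> laurent_abs (laurent_eval P \<xi>)"
        unfolding powr_minus by (simp add: field_simps)
      moreover have "?Q powr (- ((w - 1) * h)) \<le> ?Q powr (- (h + n * g))"
      proof (intro powr_mono)
        have "h + n * g \<le> h + real d * K j + C"
          using ng unfolding C_def by (simp add: distrib_left)
        thus "- ((w - 1) * h) \<le> - (h + n * g)" using j(2) by simp
      qed (use Q in auto)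
      ultimately show ?thesis by (simp add: h_def)
    next
      case 2
      have "2 * h + (n - 1) * g + (real (degree b) + real (degree (b - a)) - K (Suc j)) < 0"
      proof -
        have "(real d - 1) * (K j + real (degree a)) \<le> (real d - 1) * K j + real d * real (degree a)"
          by (simp add: algebra_simps)
        thus ?thesis using ng' j(1) unfolding C_def by linarith
      qed
      hence "?Q powr (2 * h + (n - 1) * g + (real (degree b) + real (degree (b - a)) - K (Suc j))) < 1"
        using powr_less_mono[of _ 0 ?Q] Q by simp
      also have "\<dots> \<le> laurent_abs (laurent_eval (G j) \<xi>) / height (G j) * ?Q powr (2 * h + n * g)"
        by (rule 2)
      also have "\<dots> = ?Q powr (2 * h + (n - 1) * g + (real (degree b) + real (degree (b - a)) - K (Suc j)))"
        unfolding laurent_abs_G heights powr_diff[symmetric] powr_add[symmetric]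
        by (simp add: algebra_simps)
      finally show ?thesis by simp
    qed
  qed
  thus ?thesis using that by blast
qed

text \<open>The finitely many \<open>j\<close> before the ratio settles are absorbed into
  \<open>c\<close>, so the inequality holds for all \<open>j\<close>.\<close>

lemma K_Suc_le:
  assumes "0 < e"
  obtains c where "0 \<le> c" "\<And>j. K (Suc j) \<le> (w + e) * K j + c"
proof -
  have "eventually (\<lambda>j. K (Suc j) / K j < w + e) sequentially"
    using assms by (intro order_tendstoD(2)[OF K_ratio]) simp
  then obtain N where N: "\<And>j. N \<le> j \<Longrightarrow> K (Suc j) / K j < w + e"
    by (auto simp: eventually_sequentially)
  have sum: "K (Suc j) \<le> (\<Sum>i<N. K (Suc i))" if "j < N" for j
    using that by (intro member_le_sum[of j _ "\<lambda>i. K (Suc i)"]) (auto intro: less_imp_le[OF K_pos])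
  have sum0: "0 \<le> (\<Sum>i<N. K (Suc i))" by (intro sum_nonneg less_imp_le[OF K_pos])
  have K0: "0 \<le> (w + e) * K j" for j using w_ge_7 assms K_pos[of j] by simp
  have "K (Suc j) \<le> (w + e) * K j + (\<Sum>i<N. K (Suc i))" for j
  proof (cases "j < N")
    case True
    thus ?thesis using sum[OF True] K0[of j] by linarith
  next
    case False
    thus ?thesis using N[of j] K_pos[of j] sum0 by (simp add: pos_divide_less_eq)
  qed
  thus ?thesis using that sum0 by blast
qed

lemma K_Suc_ge:
  assumes "u < w"
  shows "eventually (\<lambda>j. u * K j + c \<le> K (Suc j)) sequentially"
proof -
  \<comment> \<open>The midpoint leaves a gap \<open>(u' - u) * K j\<close> that outgrows the
    constant \<open>c\<close>.\<close>
  define u' where "u' = (u + w) / 2"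
  have u': "u < u'" "u' < w" using assms by (auto simp: u'_def)
  have "eventually (\<lambda>j. u' < K (Suc j) / K j) sequentially"
    by (rule order_tendstoD(1)[OF K_ratio u'(2)])
  moreover have "eventually (\<lambda>j. c / (u' - u) \<le> K j) sequentially"
    using K_at_top by (simp add: filterlim_at_top)
  ultimately show ?thesis
  proof eventually_elim
    case (elim j)
    have "u' * K j < K (Suc j)" using elim(1) K_pos[of j] by (simp add: pos_less_divide_eq)
    moreover have "c \<le> K j * (u' - u)" using elim(2) u' by (simp add: pos_divide_le_eq)
    ultimately show ?case by (simp add: algebra_simps)
  qed
qed

lemma G_lower_bound:
  assumes "0 < e"
  obtains c where "0 \<le> c" "\<And>j. real CARD('a) powr (- ((w + e) * real (log_height (G j)) + c))
    \<le> laurent_abs (laurent_eval (G j) \<xi>)"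
proof -
  obtain c where c: "0 \<le> c" "\<And>j. K (Suc j) \<le> (w + e) * K j + c" using K_Suc_le[OF assms] by blast
  have "real CARD('a) powr (- ((w + e) * real (log_height (G j)) + ((w + e) * real (degree b) + c)))
    \<le> laurent_abs (laurent_eval (G j) \<xi>)" for j
    unfolding laurent_abs_G
  proof (rule powr_mono)
    have "(w + e) * K j \<le> (w + e) * (real (log_height (G j)) + real (degree b))"
      using w_ge_7 assms log_height_G_ge by (intro mult_left_mono) auto
    thus "- ((w + e) * real (log_height (G j)) + ((w + e) * real (degree b) + c))
      \<le> real (degree b) + real (degree (b - a)) - K (Suc j)"
      using c(2)[of j] by (simp add: distrib_left)
  qed (use card_field_gt_1[where 'a='a] in auto)
  moreover have "0 \<le> (w + e) * real (degree b) + c" using w_ge_7 assms c by simp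
  ultimately show ?thesis using that by blast
qed

lemma dvd_G:
  assumes "irreducible P" "P dvd G j"
  obtains e where "e \<noteq> 0" "G j = smult [:e:] P" "log_height (G j) = log_height P"
    "laurent_abs (laurent_eval (G j) \<xi>) = laurent_abs (laurent_eval P \<xi>)"
proof -
  obtain e where e: "e \<noteq> 0" "G j = smult [:e:] P"
    using irreducible_dvd_irreducible[OF assms(1) irreducible_G assms(2)] .
  thus ?thesis by (intro that[of e]) (simp_all add: log_height_smult_const laurent_abs_const)
qed

text \<open>There are three classes: finitely many polynomials of small height, divisors of some
  \<open>G j\<close>, and the rest, covered by the resultant bound. One additive constant serves
  all.\<close>

lemma irreducible_lower_bound_uniform:
  assumes "0 < e"
  obtains c where "0 \<le> c" "\<And>P. irreducible P \<Longrightarrow> 0 < degree P \<Longrightarrow> degree P \<le> d \<Longrightarrow>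
    laurent_eval P \<xi> \<noteq> 0 \<Longrightarrow>
    real CARD('a) powr (- ((w + e) * real (log_height P) + c)) \<le> laurent_abs (laurent_eval P \<xi>)"
proof -
  let ?Q = "real CARD('a)"
  have Q: "1 < ?Q" by (rule card_field_gt_1)
  obtain h0 where h0: "\<And>P. irreducible P \<Longrightarrow> 0 < degree P \<Longrightarrow> degree P \<le> d \<Longrightarrow>
    h0 \<le> real (log_height P) \<Longrightarrow> (\<And>j. \<not> P dvd G j) \<Longrightarrow>
    ?Q powr (- ((w - 1) * real (log_height P))) \<le> laurent_abs (laurent_eval P \<xi>)"
    using irreducible_lower_bound by blast
  obtain c1 where c1: "0 \<le> c1" "\<And>j. ?Q powr (- ((w + e) * real (log_height (G j)) + c1))
    \<le> laurent_abs (laurent_eval (G j) \<xi>)" using G_lower_bound[OF assms] by blast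
  define S where "S = {P :: 'a poly poly. degree P \<le> d \<and> log_height P \<le> nat \<lceil>h0\<rceil>}"
  \<comment> \<open>Bounds the logarithm of each value attained on the finite set
    \<open>S\<close>.\<close>
  define c2 where "c2 = (\<Sum>P\<in>S. \<bar>log ?Q (laurent_abs (laurent_eval P \<xi>))\<bar>)"
  have c2: "0 \<le> c2" by (simp add: c2_def sum_nonneg)
  have "?Q powr (- ((w + e) * real (log_height P) + (c1 + c2))) \<le> laurent_abs (laurent_eval P \<xi>)"
    if P: "irreducible P" "0 < degree P" "degree P \<le> d" "laurent_eval P \<xi> \<noteq> 0" for P
  proof -
    let ?h = "real (log_height P)"
    have h: "0 \<le> (w + e) * ?h" using w_ge_7 assms by simp
    have mono: "?thesis" if "?Q powr x \<le> laurent_abs (laurent_eval P \<xi>)"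
      "- ((w + e) * ?h + (c1 + c2)) \<le> x" for x
      by (rule order_trans[OF powr_mono that(1)]) (use that(2) Q in auto)
    consider (small) "?h < h0" | (large) "h0 \<le> ?h" "\<And>j. \<not> P dvd G j" | (G) j where "P dvd G j"
      by (meson not_le)
    thus ?thesis
    proof cases
      case small
      hence "P \<in> S" using P(3) unfolding S_def by (auto simp: le_nat_iff) linarith
      hence "\<bar>log ?Q (laurent_abs (laurent_eval P \<xi>))\<bar> \<le> c2"
        unfolding c2_def
        by (intro member_le_sum[of P _ "\<lambda>P. \<bar>log ?Q (laurent_abs (laurent_eval P \<xi>))\<bar>"])
          (auto simp: S_def finite_bounded_log_height)
      moreover have "?Q powr (log ?Q (laurent_abs (laurent_eval P \<xi>))) = laurent_abs (laurent_eval P \<xi>)"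
        using P(4) Q by (intro powr_log_cancel) auto
      ultimately show ?thesis using c1(1) h
        by (intro mono[of "log ?Q (laurent_abs (laurent_eval P \<xi>))"]) auto
    next
      case large
      have "(w - 1) * ?h \<le> (w + e) * ?h" using assms by (intro mult_right_mono) auto
      thus ?thesis using h0[OF P(1-3) large] c1(1) c2
        by (intro mono[of "- ((w - 1) * ?h)"]) auto
    next
      case G
      obtain z where "log_height (G j) = log_height P"
        "laurent_abs (laurent_eval (G j) \<xi>) = laurent_abs (laurent_eval P \<xi>)"
        using dvd_G[OF P(1) G] by blast
      thus ?thesis using c1(2)[of j] c2 by (intro mono[of "- ((w + e) * ?h + c1)"]) auto
    qed
  qed
  thus ?thesis using that[of "c1 + c2"] c1(1) c2 by auto
qed

text \<open>Values multiply while \<open>log_height\<close> and \<open>degree\<close> add, so the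
  bound passes to products. Charging \<open>c\<close> per unit of degree pays for each nonconstant
  irreducible factor; factors in \<open>T\<close> alone have absolute value at least 1.\<close>

lemma poly_lower_bound:
  assumes "0 < e"
  obtains c where "0 \<le> c" "\<And>P. degree P \<le> d \<Longrightarrow> laurent_eval P \<xi> \<noteq> 0 \<Longrightarrow>
    real CARD('a) powr (- ((w + e) * real (log_height P) + c * real (degree P))) \<le> laurent_abs (laurent_eval P \<xi>)"
proof -
  let ?Q = "real CARD('a)"
  have Q: "1 < ?Q" by (rule card_field_gt_1)
  obtain c where c: "0 \<le> c" "\<And>P. irreducible P \<Longrightarrow> 0 < degree P \<Longrightarrow> degree P \<le> d \<Longrightarrow>
    laurent_eval P \<xi> \<noteq> 0 \<Longrightarrow>
    ?Q powr (- ((w + e) * real (log_height P) + c)) \<le> laurent_abs (laurent_eval P \<xi>)"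
    using irreducible_lower_bound_uniform[OF assms] by blast
  have const: "?Q powr (- ((w + e) * real (log_height P) + c * real (degree P))) \<le> laurent_abs (laurent_eval P \<xi>)"
    if P: "P \<noteq> 0" "degree P = 0" for P
  proof -
    obtain k where k: "P = [:k:]" using P(2) by (auto elim: degree_eq_zeroE)
    have "0 \<le> (w + e) * real (log_height P) + c * real (degree P)"
      using w_ge_7 assms c(1) by (intro add_nonneg_nonneg mult_nonneg_nonneg) auto
    hence "?Q powr (- ((w + e) * real (log_height P) + c * real (degree P))) \<le> ?Q powr 0"
      using Q by (intro powr_mono) linarith+
    also have "\<dots> \<le> laurent_abs (laurent_of_poly k)"
      using Q P k by (simp add: laurent_abs_of_poly_ge_1)
    finally show ?thesis by (simp add: k)
  qed
  have "degree P \<le> d \<longrightarrow> laurent_eval P \<xi> \<noteq> 0 \<longrightarrow>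
    ?Q powr (- ((w + e) * real (log_height P) + c * real (degree P))) \<le> laurent_abs (laurent_eval P \<xi>)"
    if "P \<noteq> 0" for P
    using that
  proof (induction P rule: bivariate_factor_induct)
    case (unit u)
    hence "u \<noteq> 0" "degree u = 0" by (auto simp: is_unit_bivariate_iff)
    thus ?case using const by blast
  next
    case (irreducible A)
    show ?case
    proof (intro impI)
      assume A: "degree A \<le> d" "laurent_eval A \<xi> \<noteq> 0"
      show "?Q powr (- ((w + e) * real (log_height A) + c * real (degree A))) \<le> laurent_abs (laurent_eval A \<xi>)"
      proof (cases "degree A = 0")
        case True
        moreover have "A \<noteq> 0" using A(2) by auto
        ultimately show ?thesis using const by blast
      next
        case False
        have "c * 1 \<le> c * real (degree A)" using False c(1) by (intro mult_left_mono) auto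
        hence "?Q powr (- ((w + e) * real (log_height A) + c * real (degree A)))
            \<le> ?Q powr (- ((w + e) * real (log_height A) + c))" using Q by (intro powr_mono) auto
        thus ?thesis using c(2)[OF irreducible _ A] False by simp
      qed
    qed
  next
    case (mult A B)
    show ?case
    proof (intro impI)
      assume AB: "degree (A * B) \<le> d" "laurent_eval (A * B) \<xi> \<noteq> 0"
      have deg: "degree (A * B) = degree A + degree B" using mult by (simp add: degree_mult_eq)
      have "?Q powr (- ((w + e) * real (log_height (A * B)) + c * real (degree (A * B)))) =
        ?Q powr (- ((w + e) * real (log_height A) + c * real (degree A))) *
        ?Q powr (- ((w + e) * real (log_height B) + c * real (degree B)))"
        using mult by (simp add: deg log_height_mult algebra_simps flip: powr_add)
      also have "\<dots> \<le> laurent_abs (laurent_eval A \<xi>) * laurent_abs (laurent_eval B \<xi>)"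
        using mult AB deg by (intro mult_mono) auto
      finally show "?Q powr (- ((w + e) * real (log_height (A * B)) + c * real (degree (A * B))))
        \<le> laurent_abs (laurent_eval (A * B) \<xi>)" by simp
    qed
  qed
  thus ?thesis using that[of c] c(1) by (metis laurent_eval_0)
qed

lemma log_height_G_unbounded:
  assumes "eventually R sequentially"
  shows "\<exists>j. R j \<and> x < real (log_height (G j))"
proof -
  have "eventually (\<lambda>j. x + real (degree b) < K j) sequentially"
    using K_at_top by (simp add: filterlim_at_top_dense)
  hence "eventually (\<lambda>j. R j \<and> x + real (degree b) < K j) sequentially"
    using assms by eventually_elim auto
  then obtain j where "R j" "x + real (degree b) < K j"
    using eventually_happens'[OF sequentially_bot] by blast
  thus ?thesis using log_height_G_ge[of j] by (intro exI[of _ j]) auto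
qed

text \<open>From below the \<open>G j\<close> themselves are witnesses, hence
  \<open>2 \<le> n\<close>. From above, \<open>poly_lower_bound\<close> leaves only finitely many
  heights.\<close>

lemma w_exp_eq:
  assumes "2 \<le> n" "n \<le> d"
  shows "w_exp n \<xi> = ereal w"
  unfolding w_exp_def
proof (rule Sup_ereal_eqI)
  let ?Q = "real CARD('a)"
  have Q: "1 < ?Q" by (rule card_field_gt_1)
  show "0 < w" using w_ge_7 by simp
  fix u :: real
  let ?S = "{P :: 'a poly poly. degree P \<le> n \<and> 0 < laurent_abs (laurent_eval P \<xi>) \<and>
    laurent_abs (laurent_eval P \<xi>) \<le> height P powr (- u)}"
  show "u \<le> w" if u: "u \<in> {u. infinite {P :: 'a poly poly. degree P \<le> n \<and>
      0 < laurent_abs (laurent_eval P \<xi>) \<and> laurent_abs (laurent_eval P \<xi>) \<le> height P powr (- u)}}"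
  proof (rule ccontr)
    assume "\<not> u \<le> w"
    \<comment> \<open>Half of the excess goes into \<open>poly_lower_bound\<close>, the other half
      bounds the height.\<close>
    define e where "e = (u - w) / 2"
    have e: "0 < e" "u = w + 2 * e" using \<open>\<not> u \<le> w\<close> by (auto simp: e_def)
    obtain c where c: "0 \<le> c" "\<And>P. degree P \<le> d \<Longrightarrow> laurent_eval P \<xi> \<noteq> 0 \<Longrightarrow>
      ?Q powr (- ((w + e) * real (log_height P) + c * real (degree P))) \<le> laurent_abs (laurent_eval P \<xi>)"
      using poly_lower_bound[OF e(1)] by blast
    have "?S \<subseteq> {P. degree P \<le> n \<and> log_height P \<le> nat \<lfloor>c * real d / e\<rfloor>}"
    proof
      fix P assume P: "P \<in> ?S"
      hence nz: "laurent_eval P \<xi> \<noteq> 0" "degree P \<le> d" "P \<noteq> 0" using assms by auto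
      have "?Q powr (- ((w + e) * real (log_height P) + c * real (degree P))) \<le> height P powr (- u)"
        using c(2)[OF nz(2,1)] P by auto
      also have "\<dots> = ?Q powr (- (u * real (log_height P)))"
        using nz(3) by (simp add: height_eq_powr powr_powr mult.commute)
      finally have "u * real (log_height P) \<le> (w + e) * real (log_height P) + c * real (degree P)"
        using Q by simp
      moreover have "c * real (degree P) \<le> c * real d" using c(1) nz(2) by (intro mult_left_mono) auto
      ultimately have "real (log_height P) * e \<le> c * real d" by (simp add: e(2) algebra_simps)
      hence "real (log_height P) \<le> c * real d / e" using e(1) by (simp add: pos_le_divide_eq)
      thus "P \<in> {P. degree P \<le> n \<and> log_height P \<le> nat \<lfloor>c * real d / e\<rfloor>}"
        using P by (auto simp: le_nat_floor)
    qed
    hence "finite ?S" using finite_bounded_log_height finite_subset by blast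
    thus False using u by simp
  qed
  show "u \<in> {u. infinite {P :: 'a poly poly. degree P \<le> n \<and>
      0 < laurent_abs (laurent_eval P \<xi>) \<and> laurent_abs (laurent_eval P \<xi>) \<le> height P powr (- u)}}"
    if u: "0 \<le> u" "u < w"
  proof (simp only: mem_Collect_eq, rule infinite_if_unbounded)
    fix x
    obtain j where j: "u * K j + (u * real (degree a) + real (degree b) + real (degree (b - a))) \<le> K (Suc j)"
      "x < real (log_height (G j))"
      using log_height_G_unbounded[OF K_Suc_ge[OF u(2)]] by blast
    have "u * real (log_height (G j)) \<le> u * (K j + real (degree a))"
      using u(1) log_height_G_le by (intro mult_left_mono)
    hence "real (degree b) + real (degree (b - a)) - K (Suc j) \<le> real (log_height (G j)) * - u"
      using j(1) by (simp add: algebra_simps)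
    hence "laurent_abs (laurent_eval (G j) \<xi>) \<le> height (G j) powr (- u)"
      using Q G_nonzero[of j] unfolding laurent_abs_G by (simp add: height_eq_powr powr_powr)
    moreover have "0 < laurent_abs (laurent_eval (G j) \<xi>)" unfolding laurent_abs_G using Q by simp
    ultimately have "G j \<in> ?S" using assms degree_G[of j] by simp
    thus "\<exists>P\<in>?S. x < real (log_height P)" using j(2) by blast
  qed
qed

end

section \<open>The exponent of approximation by algebraic elements\<close>

locale sparse_cf_abs = sparse_cf a b d w + extended_abs v
  for a b :: "'a::finite_field poly" and d :: nat and w :: real
    and v :: "'a fls alg_closure \<Rightarrow> real"
begin

lemma G_coeffs: "G j = [:coeff (G j) 0, coeff (G j) 1, coeff (G j) 2:]"
  using degree_G[of j]
  by (intro poly_eqI) (simp add: coeff_pCons coeff_eq_0 numeral_2_eq_2 split: nat.split)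

lemma G_taylor:
  assumes "closure_eval (G j) \<alpha> = 0"
  shows "laurent_abs (laurent_eval (G j) \<xi>) \<le> v (to_ac \<xi> - \<alpha>) *
    (real CARD('a) ^ degree a + height (G j) * v (to_ac \<xi> - \<alpha>))"
proof -
  have "laurent_abs (laurent_eval (G j) \<xi>) \<le> v (to_ac \<xi> - \<alpha>) *
    (laurent_abs (laurent_eval (pderiv (G j)) \<xi>) + laurent_abs (laurent_of_poly (coeff (G j) 2)) * v (to_ac \<xi> - \<alpha>))"
    using quadratic_taylor[of "coeff (G j) 0" "coeff (G j) 1" "coeff (G j) 2" \<alpha> \<xi>] assms
    unfolding G_coeffs[of j, symmetric] by blast
  also have "\<dots> \<le> v (to_ac \<xi> - \<alpha>) *
    (real CARD('a) ^ degree a + height (G j) * v (to_ac \<xi> - \<alpha>))"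
    unfolding laurent_abs_pderiv_G
    using v_nonneg laurent_abs_coeff_le_height[OF G_nonzero]
    by (intro mult_left_mono add_left_mono mult_right_mono) auto
  finally show ?thesis .
qed

text \<open>If \<open>P\<close> divides no \<open>G j\<close>, its value at \<open>\<xi>\<close> is
  at most a constant times height times distance, to be compared with the lower bound of exponent
  \<open>w - 1\<close>. For divisors of \<open>G j\<close> the derivative is bounded, so no height
  factor is lost, and the lower bound has exponent close to \<open>w\<close>.\<close>

lemma w_star_exp_upper:
  assumes "n \<le> d" "w - 1 < u"
  shows "finite {\<alpha>. algebraic_elem \<alpha> \<and> elem_degree \<alpha> \<le> n \<and> 0 < v (to_ac \<xi> - \<alpha>) \<and>
     v (to_ac \<xi> - \<alpha>) \<le> elem_height \<alpha> powr (- u - 1)}" (is "finite ?S")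
proof -
  let ?Q = "real CARD('a)"
  have Q: "1 < ?Q" by (rule card_field_gt_1)
  define e where "e = (u + 1 - w) / 2"
  have e: "0 < e" "u + 1 = w + 2 * e" using assms(2) by (auto simp: e_def)
  obtain h0 where h0: "\<And>P. irreducible P \<Longrightarrow> 0 < degree P \<Longrightarrow> degree P \<le> d \<Longrightarrow>
    h0 \<le> real (log_height P) \<Longrightarrow> (\<And>j. \<not> P dvd G j) \<Longrightarrow>
    ?Q powr (- ((w - 1) * real (log_height P))) \<le> laurent_abs (laurent_eval P \<xi>)"
    using irreducible_lower_bound by blast
  obtain c where c: "0 \<le> c" "\<And>j. ?Q powr (- ((w + e) * real (log_height (G j)) + c))
    \<le> laurent_abs (laurent_eval (G j) \<xi>)" using G_lower_bound[OF e(1)] by blast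
  define C where "C = (2 :: real) ^ Suc d"
  define D where "D = ?Q powr c * (?Q ^ degree a + 1)"
  have CD: "0 < C" "0 < D" using Q by (auto simp: C_def D_def intro!: mult_pos_pos add_pos_pos)
  \<comment> \<open>One bound for each of the three cases below.\<close>
  define M where "M = max h0 (max (log ?Q C / (2 * e)) (log ?Q D / e))"
  have "real (log_height (min_poly \<alpha>)) \<le> M" if \<alpha>: "\<alpha> \<in> ?S" for \<alpha>
  proof -
    define P where "P = min_poly \<alpha>"
    define h where "h = real (log_height P)"
    define t where "t = v (to_ac \<xi> - \<alpha>)"
    have P: "irreducible P" "0 < degree P" "closure_eval P \<alpha> = 0" "degree P \<le> d" "P \<noteq> 0"
      using \<alpha> min_poly_properties[of \<alpha>] assms(1) by (auto simp: P_def elem_degree_def)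
    have height: "height P = ?Q powr h" using P(5) by (simp add: h_def height_eq_powr)
    have "h * (- u - 1) = - ((w + 2 * e) * h)"
      unfolding e(2)[symmetric] by (simp add: algebra_simps)
    moreover have "0 < t" "t \<le> ?Q powr (h * (- u - 1))"
      using \<alpha> by (auto simp: t_def elem_height_def height powr_powr simp flip: P_def)
    ultimately have t: "0 < t" "t \<le> ?Q powr (- ((w + 2 * e) * h))"
      by simp_all
    \<comment> \<open>Yields both \<open>v \<alpha> \<le> 2\<close> and boundedness of the quadratic
      term in \<open>G_taylor\<close>.\<close>
    have neg: "?Q powr (- ((w + 2 * e) * h)) \<le> ?Q powr (- h)"
    proof (intro powr_mono)
      have "1 * h \<le> (w + 2 * e) * h" using w_ge_7 e(1) by (intro mult_right_mono) (auto simp: h_def)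
      thus "- ((w + 2 * e) * h) \<le> - h" by simp
    qed (use Q in auto)
    have "?Q powr (- h) \<le> ?Q powr 0" using Q by (intro powr_mono) (auto simp: h_def)
    also have "?Q powr 0 = 1" using Q by simp
    finally have t1: "t \<le> 1" by (rule order_trans[OF order_trans[OF t(2) neg]])
    have "to_ac \<xi> - (to_ac \<xi> - \<alpha>) = \<alpha>" by simp
    hence "v \<alpha> \<le> laurent_abs \<xi> + t" using v_diff_le[of "to_ac \<xi>" "to_ac \<xi> - \<alpha>"] by (simp add: t_def v_to_ac)
    hence v2: "v \<alpha> \<le> 2" using xi_le_1 t1 by simp
    consider (small) "h < h0" | (large) "h0 \<le> h" "\<And>j. \<not> P dvd G j" | (G) j where "P dvd G j"
      by (meson not_le)
    hence "h \<le> M"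
    proof cases
      case small
      thus ?thesis by (simp add: M_def)
    next
      case large
      have "laurent_abs (laurent_eval P \<xi>) = v (closure_eval P (to_ac \<xi>) - closure_eval P \<alpha>)"
        by (simp add: P(3) closure_eval_to_ac v_to_ac)
      also have "\<dots> \<le> (2 ^ Suc (degree P) - 1) * (t * height P)"
        unfolding t_def
        by (intro v_eval_diff_le xi_le_1 v2 laurent_abs_coeff_le_height P(5))
      also have "\<dots> \<le> C * (t * height P)"
      proof (intro mult_right_mono)
        have "(2::real) ^ Suc (degree P) \<le> C" unfolding C_def using P(4) by (intro power_increasing) auto
        thus "2 ^ Suc (degree P) - 1 \<le> C" by simp
      qed (use t(1) height in simp)
      also have "\<dots> \<le> C * (?Q powr (- ((w + 2 * e) * h)) * ?Q powr h)"
        unfolding height using t CD by (intro mult_left_mono mult_right_mono) auto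
      finally have le: "laurent_abs (laurent_eval P \<xi>) \<le> C * ?Q powr (- ((w + 2 * e) * h) + h)"
        by (simp only: powr_add)
      have "?Q powr (- ((w - 1) * h)) \<le> C * ?Q powr (- ((w + 2 * e) * h) + h)"
        using h0[OF P(1,2,4) _ large(2)] large(1) le by (auto simp: h_def)
      hence "?Q powr (- ((w - 1) * h)) / ?Q powr (- ((w + 2 * e) * h) + h) \<le> C"
        using Q by (simp add: pos_divide_le_eq)
      hence "?Q powr ((2 * e) * h) \<le> C"
        unfolding powr_diff[symmetric] by (simp add: algebra_simps)
      hence "h \<le> log ?Q C / (2 * e)" using Q e(1) CD by (intro powr_le_imp_le_log) auto
      thus ?thesis by (simp add: M_def)
    next
      case G
      obtain z where z: "z \<noteq> 0" "G j = smult [:z:] P" "log_height (G j) = log_height P"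
        using dvd_G[OF P(1) G] by blast
      have hG: "height (G j) = ?Q powr h" using z(3) G_nonzero[of j] by (simp add: height_eq_powr h_def)
      have "?Q powr (- ((w + e) * h + c)) \<le> laurent_abs (laurent_eval (G j) \<xi>)"
        using c(2)[of j] by (simp add: z(3) h_def)
      also have "\<dots> \<le> t * (?Q ^ degree a + ?Q powr h * t)"
        unfolding t_def hG[symmetric] by (rule G_taylor) (simp add: z(2) P(3))
      also have "\<dots> \<le> ?Q powr (- ((w + 2 * e) * h)) * (?Q ^ degree a + 1)"
      proof (intro mult_mono add_left_mono t(2))
        have "?Q powr h * t \<le> ?Q powr h * ?Q powr (- h)"
          using t(2) neg by (intro mult_left_mono) auto
        also have "\<dots> = 1" using Q by (simp flip: powr_add)
        finally show "?Q powr h * t \<le> 1" .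
      qed (use t(1) in auto)
      finally have "?Q powr (- ((w + e) * h + c)) / ?Q powr (- ((w + 2 * e) * h)) \<le> ?Q ^ degree a + 1"
        using Q by (simp add: pos_divide_le_eq mult.commute)
      hence "?Q powr (e * h - c) \<le> ?Q ^ degree a + 1"
        unfolding powr_diff[symmetric] by (simp add: algebra_simps)
      hence "?Q powr (e * h) \<le> D"
        using Q by (simp add: D_def powr_diff pos_divide_le_eq mult.commute)
      hence "h \<le> log ?Q D / e" using Q e(1) CD by (intro powr_le_imp_le_log) auto
      thus ?thesis by (simp add: M_def)
    qed
    thus ?thesis by (simp add: h_def P_def)
  qed
  hence "?S \<subseteq> {\<alpha>. algebraic_elem \<alpha> \<and> elem_degree \<alpha> \<le> n \<and> log_height (min_poly \<alpha>) \<le> nat \<lfloor>M\<rfloor>}"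
    by (auto intro: le_nat_floor)
  thus ?thesis using finite_algebraic_bounded finite_subset by blast
qed

text \<open>The near root of \<open>G j\<close> is the witness; a derivative of absolute value at
  least 1 transfers smallness from the value to the distance at the cost of a factor 2.\<close>

lemma w_star_exp_lower:
  assumes "2 \<le> n" "0 \<le> u" "u < w - 1"
  shows "infinite {\<alpha>. algebraic_elem \<alpha> \<and> elem_degree \<alpha> \<le> n \<and> 0 < v (to_ac \<xi> - \<alpha>) \<and>
     v (to_ac \<xi> - \<alpha>) \<le> elem_height \<alpha> powr (- u - 1)}" (is "infinite ?S")
proof (rule infinite_if_unbounded[where f = "\<lambda>\<alpha>. real (log_height (min_poly \<alpha>))"])
  fix x
  let ?Q = "real CARD('a)"
  have Q: "1 < ?Q" by (rule card_field_gt_1)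
  have Q2: "2 \<le> ?Q" using Q by simp
  have u1: "u + 1 < w" using assms(3) by simp
  \<comment> \<open>The final \<open>+ 1\<close> pays for the factor 2, which is at most
    \<open>q\<close>.\<close>
  obtain j where j: "(u + 1) * K j + ((u + 1) * real (degree a) + real (degree b) + real (degree (b - a)) + 1) \<le> K (Suc j)"
    "x < real (log_height (G j))"
    using log_height_G_unbounded[OF K_Suc_ge[OF u1]] by blast
  have "1 \<le> laurent_abs (laurent_eval (pderiv (G j)) \<xi>)"
    using Q by (simp add: laurent_abs_pderiv_G)
  moreover have "coeff (G j) 2 \<noteq> 0" using degree_G[of j] G_nonzero[of j] by (metis leading_coeff_0_iff)
  ultimately obtain \<alpha> where \<alpha>: "closure_eval (G j) \<alpha> = 0"
    "v (to_ac \<xi> - \<alpha>) \<le> 2 * laurent_abs (laurent_eval (G j) \<xi>)"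
    using quadratic_close_root[of "coeff (G j) 2" "coeff (G j) 0" "coeff (G j) 1" \<xi>]
    unfolding G_coeffs[of j, symmetric] by blast
  obtain c where c: "c \<noteq> 0" "min_poly \<alpha> = smult [:c:] (G j)"
  proof (rule min_poly_eq_smult[OF irreducible_G _ \<alpha>(1)])
    show "0 < degree (G j)" by (simp add: degree_G)
  qed
  have lh: "log_height (min_poly \<alpha>) = log_height (G j)"
    using c by (simp add: log_height_smult_const)
  have nz: "min_poly \<alpha> \<noteq> 0" using c G_nonzero by simp
  have "elem_degree \<alpha> = 2" using c degree_G by (simp add: elem_degree_def)
  moreover have "algebraic_elem \<alpha>" using \<alpha>(1) G_nonzero unfolding algebraic_elem_def by blast
  moreover have "0 < v (to_ac \<xi> - \<alpha>)"
  proof -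
    have "to_ac \<xi> \<noteq> \<alpha>"
    proof
      assume "to_ac \<xi> = \<alpha>"
      hence "laurent_eval (G j) \<xi> = 0" using \<alpha>(1) closure_eval_to_ac[of "G j" \<xi>] by simp
      thus False using laurent_abs_G[of j] Q by simp
    qed
    thus ?thesis using v_nonneg[of "to_ac \<xi> - \<alpha>"] v_eq_0_iff[of "to_ac \<xi> - \<alpha>"] by simp
  qed
  moreover have "v (to_ac \<xi> - \<alpha>) \<le> elem_height \<alpha> powr (- u - 1)"
  proof -
    have "v (to_ac \<xi> - \<alpha>) \<le> ?Q powr 1 * laurent_abs (laurent_eval (G j) \<xi>)"
      using \<alpha>(2) Q2 mult_right_mono[OF Q2, of "laurent_abs (laurent_eval (G j) \<xi>)"] by simp
    also have "\<dots> = ?Q powr (1 + (real (degree b) + real (degree (b - a)) - K (Suc j)))"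
      unfolding laurent_abs_G powr_add ..
    also have "\<dots> \<le> ?Q powr (real (log_height (G j)) * (- u - 1))"
    proof (intro powr_mono)
      have "(u + 1) * real (log_height (G j)) \<le> (u + 1) * (K j + real (degree a))"
        using assms(2) log_height_G_le by (intro mult_left_mono) auto
      thus "1 + (real (degree b) + real (degree (b - a)) - K (Suc j)) \<le> real (log_height (G j)) * (- u - 1)"
        using j(1) by (simp add: algebra_simps)
    qed (use Q in auto)
    also have "\<dots> = elem_height \<alpha> powr (- u - 1)"
      using nz by (simp add: elem_height_def height_eq_powr lh powr_powr)
    finally show ?thesis .
  qed
  ultimately have "\<alpha> \<in> ?S" using assms(1) by simp
  thus "\<exists>\<alpha>\<in>?S. x < real (log_height (min_poly \<alpha>))" using j(2) lh by auto
qed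

lemma w_star_exp_eq:
  assumes "2 \<le> n" "n \<le> d"
  shows "w_star_exp v n \<xi> = ereal (w - 1)"
  unfolding w_star_exp_def
proof (rule Sup_ereal_eqI)
  show "0 < w - 1" using w_ge_7 by simp
qed (use w_star_exp_upper[OF assms(2)] w_star_exp_lower[OF assms(1)] in \<open>auto simp: not_le[symmetric]\<close>)

end

theorem theorem2p9:
  fixes a b :: "'a::finite_field poly"
    and v :: "'a fls alg_closure \<Rightarrow> real"
    and d :: nat and w :: real
  assumes "extends_laurent_abs v"
    and "d \<ge> 2"
    and "w \<ge> (3 * real d + 2 + sqrt (9 * real d ^ 2 + 4 * real d + 4)) / 2"
    and "a \<noteq> b"
    and "degree a > 0" and "degree b > 0"
  shows "\<forall>n. 2 \<le> n \<and> n \<le> d \<longrightarrow>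
    w_star_exp v n (cf_value (cf_seq a b w)) = ereal (w - 1) \<and>
    w_exp n (cf_value (cf_seq a b w)) = ereal w"
proof -
  interpret sparse_cf_abs a b d w v
    by unfold_locales (use assms in auto)
  show ?thesis unfolding xi_eq using w_star_exp_eq w_exp_eq by blast
qed

end
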